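(* (Duality between $H^1(m)$ and $BMO(m)$) Let $T$ be a tree rooted at infinity with vertex set $V$, endowed with a locally doubling flow measure $m$. (i) Suppose $f\in BMO(m)$. Then the linear functional $L$ given by $$L(g)=\int_V fg\,dm,$$ initially defined on the dense subspace $H^1_{\mathrm{fin}}(m)$ of $H^1(m)$, has a unique bounded extension to $H^1(m)$, and there exists $C>0$ (independent of $f$) such that $\|L\|_{(H^1)'}\le C\|f\|_{BMO}$. (ii) Conversely, every continuous linear functional $L$ on $H^1(m)$ can be realized as in (i) for some $f\in BMO(m)$, and there exists $C>0$ (independent of $L$) such that $\|f\|_{BMO}\le C\|L\|_{(H^1)'}$.
   Context: Tree with root at infinity: $T=(V,E)$ is an (undirected) tree with geodesic distance $d$, $o\in V$ is a fixed origin, and a half-infinite geodesic starting at $o$ is fixed, identified with a boundary point, the root. For $x\in V$ let $\Pi(x)$ be the vertex of this geodesic closest to $x$; the level of $x$ is $\ell(x)=d(o,\Pi(x))-d(\Pi(x),x)$. Write $x\ge y$ iff $\ell(x)-\ell(y)=d(x,y)$. The set of sons of $x$ is $s(x)=\{y\sim x:\ \ell(y)=\ell(x)-1\}$. Flow measure: a function $m:V\to(0,\infty)$ with $m(x)=\sum_{y\in s(x)}m(y)$ for all $x\in V$; also regarded as the measure $m(A)=\sum_{x\in A}m(x)$, with $\int_A f\,dm=\sum_{y\in A}f(y)m(y)$. It is locally doubling if for every $r>0$ there is $C_r>1$ with $m(B_{2r}(x))\le C_r m(B_r(x))$ for all $x\in V$, where $B_r(x)$ is the closed ball of radius $r$ for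 $d$. Admissible trapezoids: for integers $h''>h'\ge1$ and $x_0\in V$, $R_{h'}^{h''}(x_0)=\{x\in V:\ x\le x_0,\ \ell(x_0)-h''<\ell(x)\le \ell(x_0)-h'\}$. Fix $\beta\ge12$. $\mathcal R$ is the family of all singletons $\{x_0\}$ and all $R_{h'}^{h''}(x_0)$ with $2\le h''/h'\le\beta$, $x_0\in V$. $BMO(m)$: $f_R=\frac1{m(R)}\int_R f\,dm$; $BMO(m)$ is the space of functions $f:V\to\mathbb C$ with $\|f\|_{BMO}=\sup_{R\in\mathcal R}\frac1{m(R)}\int_R|f-f_R|\,dm<\infty$, modulo constants. $H^1(m)$: a $(1,\infty)$-atom is a function $a$ supported in some $R\in\mathcal R$ with $\|a\|_\infty\le m(R)^{-1}$ and $\int_R a\,dm=0$. $H^1(m)$ is the space of all $g\in L^1(m)$ of the form $g=\sum_j\lambda_ja_j$ with $a_j$ $(1,\infty)$-atoms and $\lambda_j\in\mathbb C$, $\sum_j|\lambda_j|<\infty$; $\|g\|_{H^1}$ is the infimum of $\sum_j|\lambda_j|$ over all such decompositions. $H^1_{\mathrm{fin}}(m)$ is the subspace of finite linear combinations of $(1,\infty)$-atoms. $(H^1)'$ is the dual of $H^1(m)$. *)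

theory Defs
  imports "HOL-Analysis.Analysis"
begin

section \<open>Trees with root at infinity\<close>

text \<open>The vertex set is the whole type; a graph is given by its adjacency relation \<open>E\<close>.\<close>

definition is_cycle :: "('v \<Rightarrow> 'v \<Rightarrow> bool) \<Rightarrow> 'v list \<Rightarrow> bool" where
  "is_cycle E xs \<longleftrightarrow>
     length xs \<ge> 3 \<and> distinct xs \<and> successively E xs \<and> E (last xs) (hd xs)"

definition is_tree :: "('v \<Rightarrow> 'v \<Rightarrow> bool) \<Rightarrow> bool" where
  "is_tree E \<longleftrightarrow>
     symp E \<and> irreflp E \<and> (\<forall>x y. E\<^sup>*\<^sup>* x y) \<and> (\<nexists>xs. is_cycle E xs)"

text \<open>Geodesic distance: the least number of edges of a walk.\<close>

definition gdist :: "('v \<Rightarrow> 'v \<Rightarrow> bool) \<Rightarrow> 'v \<Rightarrow> 'v \<Rightarrow> nat" where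
  "gdist E x y = (LEAST n. (E ^^ n) x y)"

text \<open>The half-infinite geodesic \<open>w\<close> represents the root; its starting point \<open>w 0\<close>
  is the origin \<open>o\<close>.\<close>

definition geodesic_ray :: "('v \<Rightarrow> 'v \<Rightarrow> bool) \<Rightarrow> (nat \<Rightarrow> 'v) \<Rightarrow> bool" where
  "geodesic_ray E w \<longleftrightarrow> (\<forall>i j. int (gdist E (w i) (w j)) = \<bar>int i - int j\<bar>)"

text \<open>In a tree the minimiser is unique, so \<open>arg_min\<close> makes no choice here.\<close>

definition ray_proj :: "('v \<Rightarrow> 'v \<Rightarrow> bool) \<Rightarrow> (nat \<Rightarrow> 'v) \<Rightarrow> 'v \<Rightarrow> 'v" where
  "ray_proj E w x = arg_min (\<lambda>v. gdist E v x) (\<lambda>v. v \<in> range w)"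

definition level :: "('v \<Rightarrow> 'v \<Rightarrow> bool) \<Rightarrow> (nat \<Rightarrow> 'v) \<Rightarrow> 'v \<Rightarrow> int" where
  "level E w x =
     int (gdist E (w 0) (ray_proj E w x)) - int (gdist E (ray_proj E w x) x)"

definition below :: "('v \<Rightarrow> 'v \<Rightarrow> bool) \<Rightarrow> (nat \<Rightarrow> 'v) \<Rightarrow> 'v \<Rightarrow> 'v \<Rightarrow> bool" where
  "below E w y x \<longleftrightarrow> level E w x - level E w y = int (gdist E x y)"

definition sons :: "('v \<Rightarrow> 'v \<Rightarrow> bool) \<Rightarrow> (nat \<Rightarrow> 'v) \<Rightarrow> 'v \<Rightarrow> 'v set" where
  "sons E w x = {y. E x y \<and> level E w y = level E w x - 1}"

definition closed_ball :: "('v \<Rightarrow> 'v \<Rightarrow> bool) \<Rightarrow> 'v \<Rightarrow> real \<Rightarrow> 'v set" where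
  "closed_ball E x r = {y. real (gdist E x y) \<le> r}"

section \<open>Flow measures\<close>

text \<open>Local finiteness of the tree is not presupposed, hence the unordered sum over the sons.
  (It follows from local doubling, as one sees by taking \<open>r = 1/2\<close>.)\<close>

definition flow_measure ::
  "('v \<Rightarrow> 'v \<Rightarrow> bool) \<Rightarrow> (nat \<Rightarrow> 'v) \<Rightarrow> ('v \<Rightarrow> real) \<Rightarrow> bool" where
  "flow_measure E w m \<longleftrightarrow> (\<forall>x. m x > 0) \<and> (\<forall>x. (m has_sum m x) (sons E w x))"

definition vmeasure :: "('v \<Rightarrow> real) \<Rightarrow> 'v measure" where
  "vmeasure m = point_measure UNIV (\<lambda>x. ennreal (m x))"

definition locally_doubling :: "('v \<Rightarrow> 'v \<Rightarrow> bool) \<Rightarrow> ('v \<Rightarrow> real) \<Rightarrow> bool" where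
  "locally_doubling E m \<longleftrightarrow>
     (\<forall>r>0. \<exists>C>1. \<forall>x. emeasure (vmeasure m) (closed_ball E x (2 * r))
        \<le> ennreal C * emeasure (vmeasure m) (closed_ball E x r))"

section \<open>Admissible trapezoids\<close>

definition trapezoid ::
  "('v \<Rightarrow> 'v \<Rightarrow> bool) \<Rightarrow> (nat \<Rightarrow> 'v) \<Rightarrow> nat \<Rightarrow> nat \<Rightarrow> 'v \<Rightarrow> 'v set" where
  "trapezoid E w h1 h2 x0 =
     {x. below E w x x0 \<and> level E w x0 - int h2 < level E w x
         \<and> level E w x \<le> level E w x0 - int h1}"

definition admissible ::
  "('v \<Rightarrow> 'v \<Rightarrow> bool) \<Rightarrow> (nat \<Rightarrow> 'v) \<Rightarrow> real \<Rightarrow> 'v set set" where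
  "admissible E w \<beta> =
     {{x0} | x0. True} \<union>
     {trapezoid E w h1 h2 x0 | h1 h2 x0.
        1 \<le> h1 \<and> h1 < h2 \<and> 2 \<le> real h2 / real h1 \<and> real h2 / real h1 \<le> \<beta>}"

section \<open>The space BMO\<close>

text \<open>For a locally doubling flow measure all admissible sets are finite, so every function is
  integrable on them. The elements of BMO are represented by functions, the seminorm
  below being insensitive to additive constants.\<close>

definition mean_on :: "('v \<Rightarrow> real) \<Rightarrow> ('v \<Rightarrow> complex) \<Rightarrow> 'v set \<Rightarrow> complex" where
  "mean_on m f R =
     (LINT x:R|vmeasure m. f x) / complex_of_real (measure (vmeasure m) R)"

definition mean_osc :: "('v \<Rightarrow> real) \<Rightarrow> ('v \<Rightarrow> complex) \<Rightarrow> 'v set \<Rightarrow> real" where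
  "mean_osc m f R =
     (LINT x:R|vmeasure m. cmod (f x - mean_on m f R)) / measure (vmeasure m) R"

definition BMO ::
  "('v \<Rightarrow> 'v \<Rightarrow> bool) \<Rightarrow> (nat \<Rightarrow> 'v) \<Rightarrow> ('v \<Rightarrow> real) \<Rightarrow> real \<Rightarrow> ('v \<Rightarrow> complex) set" where
  "BMO E w m \<beta> = {f. bdd_above (mean_osc m f ` admissible E w \<beta>)}"

definition BMO_norm ::
  "('v \<Rightarrow> 'v \<Rightarrow> bool) \<Rightarrow> (nat \<Rightarrow> 'v) \<Rightarrow> ('v \<Rightarrow> real) \<Rightarrow> real \<Rightarrow> ('v \<Rightarrow> complex) \<Rightarrow> real" where
  "BMO_norm E w m \<beta> f = (SUP R\<in>admissible E w \<beta>. mean_osc m f R)"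

section \<open>The Hardy space\<close>

definition atom ::
  "('v \<Rightarrow> 'v \<Rightarrow> bool) \<Rightarrow> (nat \<Rightarrow> 'v) \<Rightarrow> ('v \<Rightarrow> real) \<Rightarrow> real \<Rightarrow> ('v \<Rightarrow> complex) \<Rightarrow> bool" where
  "atom E w m \<beta> a \<longleftrightarrow>
     (\<exists>R\<in>admissible E w \<beta>.
        (\<forall>x. x \<notin> R \<longrightarrow> a x = 0) \<and>
        (\<forall>x. cmod (a x) \<le> inverse (measure (vmeasure m) R)) \<and>
        (LINT x:R|vmeasure m. a x) = 0)"

text \<open>\<open>g\<close> is the sum of the series of the \<open>\<lambda>\<^sub>j a\<^sub>j\<close> in \<open>L\<^sup>1(m)\<close>.\<close>

definition atomic_decomp ::
  "('v \<Rightarrow> 'v \<Rightarrow> bool) \<Rightarrow> (nat \<Rightarrow> 'v) \<Rightarrow> ('v \<Rightarrow> real) \<Rightarrow> real \<Rightarrow> ('v \<Rightarrow> complex) \<Rightarrow>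
     (nat \<Rightarrow> complex) \<Rightarrow> (nat \<Rightarrow> 'v \<Rightarrow> complex) \<Rightarrow> bool" where
  "atomic_decomp E w m \<beta> g c a \<longleftrightarrow>
     (\<forall>j. atom E w m \<beta> (a j)) \<and> summable (\<lambda>j. cmod (c j)) \<and>
     (\<lambda>n. \<integral>\<^sup>+x. ennreal (cmod (g x - (\<Sum>j<n. c j * a j x))) \<partial>vmeasure m) \<longlonglongrightarrow> 0"

definition H1 ::
  "('v \<Rightarrow> 'v \<Rightarrow> bool) \<Rightarrow> (nat \<Rightarrow> 'v) \<Rightarrow> ('v \<Rightarrow> real) \<Rightarrow> real \<Rightarrow> ('v \<Rightarrow> complex) set" where
  "H1 E w m \<beta> = {g. integrable (vmeasure m) g \<and> (\<exists>c a. atomic_decomp E w m \<beta> g c a)}"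

definition H1_norm ::
  "('v \<Rightarrow> 'v \<Rightarrow> bool) \<Rightarrow> (nat \<Rightarrow> 'v) \<Rightarrow> ('v \<Rightarrow> real) \<Rightarrow> real \<Rightarrow> ('v \<Rightarrow> complex) \<Rightarrow> real" where
  "H1_norm E w m \<beta> g = Inf {(\<Sum>j. cmod (c j)) | c a. atomic_decomp E w m \<beta> g c a}"

definition H1_fin ::
  "('v \<Rightarrow> 'v \<Rightarrow> bool) \<Rightarrow> (nat \<Rightarrow> 'v) \<Rightarrow> ('v \<Rightarrow> real) \<Rightarrow> real \<Rightarrow> ('v \<Rightarrow> complex) set" where
  "H1_fin E w m \<beta> =
     {g. \<exists>(n::nat) c a. (\<forall>j<n. atom E w m \<beta> (a j)) \<and> g = (\<lambda>x. \<Sum>j<n. c j * a j x)}"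

section \<open>Functionals on the Hardy space\<close>

text \<open>A functional is a total function of which only the values on \<open>H1\<close> matter.\<close>

definition H1_linear ::
  "('v \<Rightarrow> 'v \<Rightarrow> bool) \<Rightarrow> (nat \<Rightarrow> 'v) \<Rightarrow> ('v \<Rightarrow> real) \<Rightarrow> real \<Rightarrow>
     (('v \<Rightarrow> complex) \<Rightarrow> complex) \<Rightarrow> bool" where
  "H1_linear E w m \<beta> L \<longleftrightarrow>
     (\<forall>g\<in>H1 E w m \<beta>. \<forall>h\<in>H1 E w m \<beta>. L (\<lambda>x. g x + h x) = L g + L h) \<and>
     (\<forall>c. \<forall>g\<in>H1 E w m \<beta>. L (\<lambda>x. c * g x) = c * L g)"

definition H1_bounded ::
  "('v \<Rightarrow> 'v \<Rightarrow> bool) \<Rightarrow> (nat \<Rightarrow> 'v) \<Rightarrow> ('v \<Rightarrow> real) \<Rightarrow> real \<Rightarrow>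
     (('v \<Rightarrow> complex) \<Rightarrow> complex) \<Rightarrow> bool" where
  "H1_bounded E w m \<beta> L \<longleftrightarrow>
     (\<exists>B. \<forall>g\<in>H1 E w m \<beta>. cmod (L g) \<le> B * H1_norm E w m \<beta> g)"

definition H1_continuous ::
  "('v \<Rightarrow> 'v \<Rightarrow> bool) \<Rightarrow> (nat \<Rightarrow> 'v) \<Rightarrow> ('v \<Rightarrow> real) \<Rightarrow> real \<Rightarrow>
     (('v \<Rightarrow> complex) \<Rightarrow> complex) \<Rightarrow> bool" where
  "H1_continuous E w m \<beta> L \<longleftrightarrow>
     (\<forall>g\<in>H1 E w m \<beta>. \<forall>\<epsilon>>0. \<exists>\<delta>>0. \<forall>h\<in>H1 E w m \<beta>.
        H1_norm E w m \<beta> (\<lambda>x. h x - g x) < \<delta> \<longrightarrow> cmod (L h - L g) < \<epsilon>)"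

definition H1_dual_norm ::
  "('v \<Rightarrow> 'v \<Rightarrow> bool) \<Rightarrow> (nat \<Rightarrow> 'v) \<Rightarrow> ('v \<Rightarrow> real) \<Rightarrow> real \<Rightarrow>
     (('v \<Rightarrow> complex) \<Rightarrow> complex) \<Rightarrow> real" where
  "H1_dual_norm E w m \<beta> L =
     Sup {cmod (L g) | g. g \<in> H1 E w m \<beta> \<and> H1_norm E w m \<beta> g \<le> 1}"

text \<open>\<open>L\<close> is a bounded linear functional on \<open>H1\<close> extending the functional
  \<open>g \<mapsto> \<integral> f g dm\<close> on \<open>H1_fin\<close>.\<close>

definition bounded_extension ::
  "('v \<Rightarrow> 'v \<Rightarrow> bool) \<Rightarrow> (nat \<Rightarrow> 'v) \<Rightarrow> ('v \<Rightarrow> real) \<Rightarrow> real \<Rightarrow>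
     ('v \<Rightarrow> complex) \<Rightarrow> (('v \<Rightarrow> complex) \<Rightarrow> complex) \<Rightarrow> bool" where
  "bounded_extension E w m \<beta> f L \<longleftrightarrow>
     H1_linear E w m \<beta> L \<and> H1_bounded E w m \<beta> L \<and>
     (\<forall>g\<in>H1_fin E w m \<beta>.
        integrable (vmeasure m) (\<lambda>x. f x * g x) \<and>
        L g = (LINT x|vmeasure m. f x * g x))"

end

theory Submission
  imports Defs
begin

text \<open>For an atom \<open>a\<close> supported in \<open>R\<close>, the cancellation of \<open>a\<close> bounds \<open>\<integral>fa\<close> by the mean
  oscillation of \<open>f\<close> on \<open>R\<close>. That the functional does not depend on the atomic decomposition is seen
  by truncation: truncations of \<open>f\<close> are bounded, so they pair with all of \<open>L\<^sup>1\<close>, obey the same bound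
  on atoms, and their pairings with a fixed element of the Hardy space converge. Conversely, any two
  vertices lie in a common admissible trapezoid below a high vertex of the ray, so
  \<open>\<delta>\<^sub>x/m(x) - \<delta>\<^sub>o/m(o)\<close> is a multiple of an atom. The values of \<open>L\<close> on these functions define \<open>f\<close>, and
  testing \<open>L\<close> on atoms built from the phase of \<open>f - f\<^sub>R\<close> controls the mean oscillations of \<open>f\<close>.\<close>

section \<open>Integration against a weight on the vertices\<close>

text \<open>The obstacle is that the Hardy norm ranges over infinite decompositions, even for a
  finite combination of atoms. Uniform control of \<integral>fa over atoms bounds the series of the
  numbers \<lambda>\<integral>fa along a decomposition of g, but for unbounded f convergence in
  \<open>L^1\<close> neither identifies its sum with \<integral>fg nor makes it independent of the
  decomposition. For a bounded multiplier it does both. Truncating complex values by a contraction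
  costs no constant: what is subtracted on an atom is the truncation of the mean of f, not the mean
  of the truncation, so the oscillation of f itself remains. Hence the constant 1 in the first part.
  As the truncation level grows, a finite piece of the decomposition stabilises while its tail is
  small uniformly in the level. In the converse, f is determined only up to a constant; subtracting
  the point mass at the origin fixes it. A phase need not have mean zero, and centring it may double
  its size: this is the constant 2. Doubling at radius 1/2 bounds the degrees, so admissible sets
  are finite and integrals over them are finite sums.\<close>

lemma emeasure_vmeasure_finite:
  assumes "finite R" "\<And>x. m x \<ge> 0"
  shows "emeasure (vmeasure m) R = ennreal (\<Sum>x\<in>R. m x)"
  unfolding vmeasure_def using assms by (simp add: emeasure_point_measure_finite2)

lemma measure_vmeasure_finite:
  assumes "finite R" "\<And>x. m x \<ge> 0"
  shows "measure (vmeasure m) R = (\<Sum>x\<in>R. m x)"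
  using assms by (simp add: measure_def emeasure_vmeasure_finite sum_nonneg)

lemma borel_measurable_vmeasure [simp]: "f \<in> borel_measurable (vmeasure m)"
  by (simp add: vmeasure_def)

lemma sets_vmeasure [simp]: "A \<in> sets (vmeasure m)"
  by (simp add: vmeasure_def sets_point_measure)

text \<open>Write \<open>f\<close> as a finite sum of constants times indicators of points. Atoms
  turn out to have finite support, so this turns their integrals into weighted sums.\<close>

lemma has_bochner_integral_finite_support:
  fixes f :: "'v \<Rightarrow> 'b::{banach, second_countable_topology}"
  assumes S: "finite S" "\<And>x. x \<notin> S \<Longrightarrow> f x = 0" and m: "\<And>x. m x \<ge> 0"
  shows "has_bochner_integral (vmeasure m) f (\<Sum>x\<in>S. m x *\<^sub>R f x)"
proof -
  have "has_bochner_integral (vmeasure m) (\<lambda>x. indicator {y} x *\<^sub>R f y) (m y *\<^sub>R f y)" for y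
    using has_bochner_integral_indicator[of "{y}" "vmeasure m" "f y"] m
    by (simp add: emeasure_vmeasure_finite measure_vmeasure_finite)
  then have "has_bochner_integral (vmeasure m) (\<lambda>x. \<Sum>y\<in>S. indicator {y} x *\<^sub>R f y)
      (\<Sum>y\<in>S. m y *\<^sub>R f y)"
    by (intro has_bochner_integral_sum)
  moreover have "(\<lambda>x. \<Sum>y\<in>S. indicator {y} x *\<^sub>R f y) = f"
  proof
    fix x
    have "(\<Sum>y\<in>S. indicator {y} x *\<^sub>R f y) = (\<Sum>y\<in>S. if y = x then f y else 0)"
      by (intro sum.cong) (auto simp: indicator_def)
    also have "\<dots> = f x"
      using S by auto
    finally show "(\<Sum>y\<in>S. indicator {y} x *\<^sub>R f y) = f x" .
  qed
  ultimately show ?thesis by simp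
qed

lemma set_integral_vmeasure_finite:
  fixes f :: "'v \<Rightarrow> 'b::{banach, second_countable_topology}"
  assumes "finite R" "\<And>x. m x \<ge> 0"
  shows "(LINT x:R|vmeasure m. f x) = (\<Sum>x\<in>R. m x *\<^sub>R f x)"
proof -
  have "has_bochner_integral (vmeasure m) (\<lambda>x. indicator R x *\<^sub>R f x)
      (\<Sum>x\<in>R. m x *\<^sub>R (indicator R x *\<^sub>R f x))"
    using assms by (intro has_bochner_integral_finite_support) auto
  then show ?thesis
    unfolding set_lebesgue_integral_def
    by (simp add: has_bochner_integral_integral_eq cong: sum.cong)
qed

lemma integrable_bounded_mult:
  fixes \<phi> g :: "'v \<Rightarrow> complex"
  assumes "\<And>x. cmod (\<phi> x) \<le> B" "integrable (vmeasure m) g"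
  shows "integrable (vmeasure m) (\<lambda>x. \<phi> x * g x)"
proof (rule Bochner_Integration.integrable_bound)
  show "integrable (vmeasure m) (\<lambda>x. complex_of_real B * g x)"
    using assms(2) by simp
  have "cmod (\<phi> x) * cmod (g x) \<le> \<bar>B\<bar> * cmod (g x)" for x
    using assms(1)[of x] by (intro mult_right_mono) auto
  then show "AE x in vmeasure m. norm (\<phi> x * g x) \<le> norm (complex_of_real B * g x)"
    by (simp add: norm_mult)
qed simp

section \<open>Geodesics in trees\<close>

lemma relpowp_gdist:
  assumes "E\<^sup>*\<^sup>* x y"
  shows "(E ^^ gdist E x y) x y"
  unfolding gdist_def using rtranclp_imp_relpowp[OF assms] by (rule LeastI_ex)

lemma gdist_le:
  assumes "(E ^^ n) x y"
  shows "gdist E x y \<le> n"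
  unfolding gdist_def using assms by (rule Least_le)

lemma successively_map_upt:
  "successively P (map f [a..<b]) \<longleftrightarrow> (\<forall>i. a \<le> i \<and> Suc i < b \<longrightarrow> P (f i) (f (Suc i)))"
proof
  assume L: "successively P (map f [a..<b])"
  show "\<forall>i. a \<le> i \<and> Suc i < b \<longrightarrow> P (f i) (f (Suc i))"
  proof (intro allI impI)
    fix i assume "a \<le> i \<and> Suc i < b"
    then show "P (f i) (f (Suc i))"
      using successively_nth[OF L, of "i - a"] by (auto simp: Suc_diff_Suc less_diff_conv)
  qed
qed (simp add: successively_conv_nth)

text \<open>A shortest walk repeats no vertex, since the stretch between two visits could be cut
  out.\<close>

lemma geodesic_path:
  assumes "E\<^sup>*\<^sup>* x y"
  obtains p where "p 0 = x" "p (gdist E x y) = y" "\<And>i. i < gdist E x y \<Longrightarrow> E (p i) (p (Suc i))"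
    "inj_on p {..gdist E x y}"
proof -
  let ?d = "gdist E x y"
  obtain p where p: "p 0 = x" "p ?d = y" "\<And>i. i < ?d \<Longrightarrow> E (p i) (p (Suc i))"
    using relpowp_gdist[OF assms] unfolding relpowp_fun_conv by blast
  have False if "i < j" "j \<le> ?d" "p i = p j" for i j
  proof -
    have 1: "(E ^^ i) x (p i)"
      unfolding relpowp_fun_conv by (rule exI[of _ p]) (use p that in auto)
    have 2: "(E ^^ (?d - j)) (p j) y"
      unfolding relpowp_fun_conv by (rule exI[of _ "\<lambda>k. p (j + k)"]) (use p that in auto)
    have "(E ^^ (i + (?d - j))) x y"
      unfolding relpowp_add using 1 2 that(3) by auto
    from gdist_le[OF this] that show False by simp
  qed
  then have "inj_on p {..?d}"
    unfolding inj_on_def by (metis atMost_iff nat_neq_iff)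
  with p that show thesis by blast
qed

text \<open>If the two paths part after their first vertex, follow one of them up to the first vertex
  that it shares with the other, and return along the other: this is a cycle.\<close>

lemma cycle_if_diverging_paths:
  assumes sym: "symp E"
    and xs: "distinct (a # x # xs)" "successively E (a # x # xs)"
    and ys: "distinct (a # y # ys)" "successively E (a # y # ys)"
    and eq: "last (x # xs) = last (y # ys)" and neq: "x \<noteq> y"
  shows "\<exists>c. is_cycle E c"
proof -
  have "\<exists>v\<in>set (y # ys). v \<in> set (x # xs)"
    using eq by (metis last_in_set list.distinct(1))
  then obtain us v vs where ys_split: "y # ys = us @ v # vs"
    and v: "v \<in> set (x # xs)" and us: "\<forall>u\<in>set us. u \<notin> set (x # xs)"
    by (rule split_list_first_propE)
  obtain us' vs' where xs_split: "x # xs = us' @ v # vs'"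
    using split_list[OF v] by blast
  let ?c = "a # us @ v # rev us'"
  have "successively E (a # us @ v # vs)" "successively E (a # us' @ v # vs')"
    using xs(2) ys(2) unfolding xs_split ys_split by - assumption+
  then have "successively E ((a # us @ [v]) @ vs)" "successively E ((a # us' @ [v]) @ vs')"
    by simp_all
  then have 1: "successively E (a # us @ [v])" and 2: "successively E (a # us' @ [v])"
    unfolding successively_append_iff by blast+
  have conv: "(\<lambda>x y. E y x) = E"
    using sym by (auto simp: symp_def fun_eq_iff)
  have 3: "successively E (v # rev us' @ [a])"
    using 2 successively_rev[of E "a # us' @ [v]", unfolded conv] by simp
  have 4: "successively E (v # rev us')" "E (last (v # rev us')) a"
    using 3 successively_append_iff[of E "v # rev us'" "[a]"] by simp_all
  have succ: "successively E ?c"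
    using 1 4(1) successively_append_iff[of E "a # us" "[v]"]
      successively_append_iff[of E "a # us" "v # rev us'"] by simp
  have closing: "E (last ?c) (hd ?c)"
    using 4(2) by simp
  have "distinct (a # us @ v # vs)" "distinct (a # us' @ v # vs')"
    using xs(1) ys(1) unfolding xs_split ys_split by - assumption+
  then have dist: "distinct ?c"
    using us unfolding xs_split by auto
  \<comment> \<open>If both were empty, \<open>x\<close> and \<open>y\<close> would both equal
    \<open>v\<close>. A vertex besides \<open>a\<close> and \<open>v\<close> is what brings the
    length to 3.\<close>
  have "us \<noteq> [] \<or> us' \<noteq> []"
    using neq xs_split ys_split by auto
  then have "length ?c \<ge> 3"
    by (cases us; cases us') auto
  then have "is_cycle E ?c"
    unfolding is_cycle_def using dist succ closing by blast
  then show ?thesis ..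
qed

text \<open>Two simple paths with common ends cannot part after their first vertex without closing a
  cycle, so they share the second vertex and induction applies to the tails. If one path is a single
  vertex, the other would have to return to its start, hence is trivial too.\<close>

lemma path_unique:
  assumes "symp E" "\<nexists>c. is_cycle E c"
    and "distinct xs" "successively E xs" "xs \<noteq> []"
    and "distinct ys" "successively E ys" "ys \<noteq> []"
    and "hd xs = hd ys" "last xs = last ys"
  shows "xs = ys"
  using assms(3-)
proof (induction xs arbitrary: ys)
  case (Cons a xs)
  obtain ys' where ys: "ys = a # ys'"
    using Cons.prems by (cases ys) auto
  show ?case
  proof (cases "xs = [] \<or> ys' = []")
    case True
    then show ?thesis
      using Cons.prems unfolding ys
      by (metis distinct.simps(2) last.simps last_in_set)
  next
    case False
    then obtain x xs1 y ys1 where s: "xs = x # xs1" "ys' = y # ys1"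
      by (meson neq_Nil_conv)
    have "x = y"
      using cycle_if_diverging_paths[OF assms(1), of a x xs1 y ys1] assms(2) Cons.prems
      unfolding ys s by auto
    then have "xs = ys'"
      using Cons.prems unfolding ys s by (intro Cons.IH[unfolded s]) auto
    then show ?thesis unfolding ys by simp
  qed
qed simp

text \<open>A geodesic is itself a simple path, so by uniqueness it coincides with the given one.
  Distances can thus be computed from any simple path.\<close>

lemma gdist_eq_path_length:
  assumes tree: "is_tree E"
    and xs: "distinct xs" "successively E xs" "xs \<noteq> []"
  shows "gdist E (hd xs) (last xs) = length xs - 1"
proof -
  let ?d = "gdist E (hd xs) (last xs)"
  have conn: "E\<^sup>*\<^sup>* (hd xs) (last xs)" and sym: "symp E" and acyc: "\<nexists>c. is_cycle E c"
    using tree unfolding is_tree_def by auto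
  obtain p where p: "p 0 = hd xs" "p ?d = last xs" "\<And>i. i < ?d \<Longrightarrow> E (p i) (p (Suc i))"
    "inj_on p {..?d}"
    using geodesic_path[OF conn] by blast
  let ?ys = "map p [0..<Suc ?d]"
  have "xs = ?ys"
  proof (rule path_unique[OF sym acyc xs])
    show "distinct ?ys"
      using p(4) by (simp only: distinct_map distinct_upt
        lessThan_Suc_atMost atLeast0LessThan set_upt)
    show "successively E ?ys"
      unfolding successively_map_upt using p(3) by simp
    show "hd xs = hd ?ys"
      using p(1) by (simp add: hd_map del: upt_Suc)
    show "last xs = last ?ys"
      using p(2) by simp
  qed simp
  then have "length xs = length ?ys" by (rule arg_cong)
  then show ?thesis by simp
qed

section \<open>Levels\<close>

lemma gdist_ray:
  assumes "geodesic_ray E w"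
  shows "gdist E (w i) (w (i + n)) = n" "gdist E (w (i + n)) (w i) = n"
proof -
  have "int (gdist E (w i) (w j)) = \<bar>int i - int j\<bar>" for i j
    using assms unfolding geodesic_ray_def by blast
  from this[of i "i + n"] this[of "i + n" i]
  show "gdist E (w i) (w (i + n)) = n" "gdist E (w (i + n)) (w i) = n" by simp_all
qed

lemma ray_proj_index:
  obtains k where "ray_proj E w x = w k" "\<And>j. gdist E (w k) x \<le> gdist E (w j) x"
proof -
  have "is_arg_min (\<lambda>v. gdist E v x) (\<lambda>v. v \<in> range w) (ray_proj E w x)"
    unfolding ray_proj_def by (rule is_arg_min_arg_min_nat[of _ "w 0"]) simp
  then show thesis
    using that by (auto simp: is_arg_min_linorder)
qed

lemma gdist_self: "gdist E x x = 0"
  using gdist_le[where n = 0] by simp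

lemma gdist_eq_0_iff:
  assumes "is_tree E"
  shows "gdist E x y = 0 \<longleftrightarrow> x = y"
proof
  assume "gdist E x y = 0"
  moreover have "(E ^^ gdist E x y) x y"
    using assms unfolding is_tree_def by (intro relpowp_gdist) blast
  ultimately show "x = y" by simp
qed (simp add: gdist_self)

lemma level_ray:
  assumes "is_tree E" "geodesic_ray E w"
  shows "level E w (w n) = int n"
proof -
  obtain k where k: "ray_proj E w (w n) = w k" "\<And>j. gdist E (w k) (w n) \<le> gdist E (w j) (w n)"
    using ray_proj_index by metis
  have "gdist E (w k) (w n) = 0"
    using k(2)[of n] by (simp add: gdist_self)
  then have "w k = w n"
    using gdist_eq_0_iff[OF assms(1)] by blast
  then show ?thesis
    unfolding level_def k(1) using gdist_ray[OF assms(2), of 0 n] by (simp add: gdist_self)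
qed

text \<open>The geodesic from \<open>x\<close> to a high vertex of the ray passes through the projection of \<open>x\<close>.\<close>

lemma eventually_below_ray:
  assumes tree: "is_tree E" and ray: "geodesic_ray E w"
  shows "\<exists>k. \<forall>n\<ge>k. below E w x (w n)"
proof -
  obtain k where k: "ray_proj E w x = w k" "\<And>j. gdist E (w k) x \<le> gdist E (w j) x"
    using ray_proj_index by metis
  have conn: "E\<^sup>*\<^sup>* u v" and sym: "symp E" for u v
    using tree unfolding is_tree_def by auto
  let ?d = "gdist E (w k) x"
  obtain p where p: "p 0 = w k" "p ?d = x" "\<And>i. i < ?d \<Longrightarrow> E (p i) (p (Suc i))"
    "inj_on p {..?d}"
    using geodesic_path[OF conn] by blast
  have edge: "E (w i) (w (Suc i))" for i
    using relpowp_gdist[OF conn, of "w i" "w (Suc i)"] gdist_ray(1)[OF ray, of i 1]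
    by (simp only: Suc_eq_plus1 relpowp_1)
  have winj: "inj w"
  proof (rule injI)
    fix i j assume eq: "w i = w j"
    have "int (gdist E (w i) (w j)) = \<bar>int i - int j\<bar>"
      using ray unfolding geodesic_ray_def by blast
    then show "i = j" unfolding eq by (simp add: gdist_self)
  qed
  \<comment> \<open>Another meeting with the ray would be a ray vertex strictly closer to
    \<open>x\<close> than the projection.\<close>
  have off: "p i \<noteq> w j" if "0 < i" "i \<le> ?d" for i j
  proof
    assume "p i = w j"
    moreover have "(E ^^ (?d - i)) (p i) x"
      unfolding relpowp_fun_conv by (rule exI[of _ "\<lambda>l. p (i + l)"]) (use p that in auto)
    ultimately have "gdist E (w j) x \<le> ?d - i"
      using gdist_le by metis
    then show False using k(2)[of j] that by simp
  qed
  have "below E w x (w n)" if "k \<le> n" for n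
  proof -
    \<comment> \<open>\<open>A\<close> descends the ray from \<open>w n\<close> to
      \<open>w k\<close>; \<open>B\<close> continues towards \<open>x\<close> and omits
      \<open>p 0 = w k\<close>, already the end of \<open>A\<close>. So \<open>A @ B\<close> is a
      simple path with \<open>n - k + ?d\<close> edges.\<close>
    define A where "A = rev (map w [k..<Suc n])"
    define B where "B = map p [1..<Suc ?d]"
    have A: "A \<noteq> []" "hd A = w n" "last A = w k" "length A = Suc (n - k)"
      using that by (simp_all add: A_def hd_rev last_rev hd_map last_map Suc_diff_le del: upt_Suc)
    have B: "length B = ?d" "B \<noteq> [] \<Longrightarrow> hd B = p 1" "B \<noteq> [] \<Longrightarrow> last B = x"
      using p(2) by (simp_all add: B_def hd_map last_map del: upt_Suc)
    have "inj_on p {1..<Suc ?d}"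
      by (rule inj_on_subset[OF p(4)]) auto
    moreover have "inj_on w {k..<Suc n}"
      by (rule inj_on_subset[OF winj]) simp
    moreover have "w ` {k..<Suc n} \<inter> p ` {1..<Suc ?d} = {}"
    proof -
      have "w j \<noteq> p i" if "i \<in> {1..<Suc ?d}" for i j
        using off[of i j] that by (metis One_nat_def Suc_le_eq atLeastLessThan_iff less_Suc_eq_le)
      then show ?thesis by blast
    qed
    ultimately have dist: "distinct (A @ B)"
      unfolding A_def B_def
      by (simp only: distinct_append distinct_rev distinct_map distinct_upt set_rev set_map set_upt
        simp_thms)
    have conv: "(\<lambda>x y. E y x) = E"
      using sym by (auto simp: symp_def fun_eq_iff)
    have "successively E (map w [k..<Suc n])"
      unfolding successively_map_upt using edge by blast
    then have "successively E A"
      unfolding A_def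
      using successively_rev[of E "map w [k..<Suc n]", unfolded conv] by (rule iffD2[rotated])
    moreover have "successively E B"
      using p(3) unfolding B_def successively_map_upt by simp
    moreover have "E (last A) (hd B)" if "B \<noteq> []"
    proof -
      have "?d > 0" using that B(1) by (metis length_greater_0_conv)
      then show ?thesis
        using A(3) B(2)[OF that] p(1) p(3)[of 0] by simp
    qed
    ultimately have "successively E (A @ B)"
      unfolding successively_append_iff by blast
    with dist have "gdist E (hd (A @ B)) (last (A @ B)) = length (A @ B) - 1"
      by (rule gdist_eq_path_length[OF tree]) (simp add: A(1))
    moreover have "hd (A @ B) = w n"
      using A(1,2) by simp
    moreover have "last (A @ B) = x"
    proof (cases "B = []")
      case True
      then have "w k = x" using p(1,2) B(1) by simp
      then show ?thesis using True A(3) by simp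
    next
      case False
      then show ?thesis using B(3) by simp
    qed
    moreover have "length (A @ B) - 1 = n - k + ?d"
      using A(4) B(1) by simp
    ultimately have "gdist E (w n) x = n - k + ?d"
      by simp
    moreover have "gdist E (w 0) (w k) = k"
      using gdist_ray(1)[OF ray, of 0 k] by simp
    ultimately show ?thesis
      unfolding below_def level_ray[OF tree ray] level_def[of E w x] k(1) using that by simp
  qed
  then show ?thesis by blast
qed

text \<open>Seen from \<open>w n\<close>, the two vertices lie at depths whose difference does not
  depend on \<open>n\<close>, so the ratio of the depths tends to 1 and for large \<open>n\<close>
  both fall between some \<open>h\<close> and \<open>2 * h\<close>.\<close>

lemma common_admissible_set:
  assumes tree: "is_tree E" and ray: "geodesic_ray E w" and "\<beta> \<ge> 2"
  shows "\<exists>R\<in>admissible E w \<beta>. x \<in> R \<and> y \<in> R"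
proof -
  obtain k k' where "\<forall>n\<ge>k. below E w x (w n)" "\<forall>n\<ge>k'. below E w y (w n)"
    using eventually_below_ray[OF tree ray] by metis
  moreover define l where "l = max (level E w x) (level E w y)"
  define l' where "l' = min (level E w x) (level E w y)"
  \<comment> \<open>With \<open>h = n - l\<close> the requirement \<open>n - 2 * h < l'\<close>
    reads \<open>n > 2 * l - l'\<close>; since \<open>l' \<le> l\<close>, the chosen bound also
    gives \<open>h \<ge> 1\<close>.\<close>
  define n where "n = max k (max k' (nat (2 * l - l' + \<bar>l\<bar> + 2)))"
  define h where "h = nat (int n - l)"
  have n: "int n \<ge> 2 * l - l' + \<bar>l\<bar> + 2" "n \<ge> k" "n \<ge> k'"
    unfolding n_def by linarith+
  have "l' \<le> l" unfolding l_def l'_def by simp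
  then have h: "int h = int n - l" "1 \<le> h"
    using n unfolding h_def by linarith+
  have "x \<in> trapezoid E w h (2 * h) (w n)" "y \<in> trapezoid E w h (2 * h) (w n)"
    using calculation n h unfolding trapezoid_def level_ray[OF tree ray]
    by (auto simp: l_def l'_def)
  moreover have "trapezoid E w h (2 * h) (w n) \<in> admissible E w \<beta>"
    unfolding admissible_def using h(2) \<open>\<beta> \<ge> 2\<close>
    by (intro UnI2 CollectI exI[of _ h] exI[of _ "2 * h"] exI[of _ "w n"]) auto
  ultimately show ?thesis by blast
qed

section \<open>Finiteness of admissible sets\<close>

text \<open>The ball of radius 1/2 is a single point and that of radius 1 contains the neighbours.
  Doubling at \<open>x\<close> bounds their total mass by \<open>C * m x\<close>; doubling at a
  neighbour \<open>y\<close>, which has \<open>x\<close> as neighbour, gives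
  \<open>m y \<ge> m x / C\<close>. So there are at most \<open>C * C\<close> of them.\<close>

lemma finite_neighbours:
  assumes tree: "is_tree E" and pos: "\<And>x. m x > 0" and doubling: "locally_doubling E m"
  shows "finite {y. E x y}"
proof -
  obtain C where C: "C > 1" and
    dbl: "\<And>x. emeasure (vmeasure m) (closed_ball E x (2 * (1/2)))
        \<le> ennreal C * emeasure (vmeasure m) (closed_ball E x (1/2))"
    using doubling unfolding locally_doubling_def by (meson half_gt_zero zero_less_one)
  have small: "closed_ball E x (1/2) = {x}" for x
    using gdist_eq_0_iff[OF tree, of x] unfolding closed_ball_def
    by (force simp: gdist_self)
  have bound: "(\<Sum>y\<in>F. m y) \<le> C * m x" if F: "finite F" "F \<subseteq> {y. E x y}" for x F
  proof -
    have "gdist E x y \<le> 1" if "E x y" for y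
      using gdist_le[where n = 1] that by (simp only: relpowp_1)
    then have sub: "F \<subseteq> closed_ball E x (2 * (1/2))"
      using F unfolding closed_ball_def by fastforce
    have "ennreal (\<Sum>y\<in>F. m y) = emeasure (vmeasure m) F"
      using F(1) pos by (simp add: emeasure_vmeasure_finite less_imp_le)
    also have "\<dots> \<le> emeasure (vmeasure m) (closed_ball E x (2 * (1/2)))"
      by (rule emeasure_mono[OF sub]) (simp add: vmeasure_def sets_point_measure)
    also have "\<dots> \<le> ennreal C * emeasure (vmeasure m) {x}"
      using dbl[of x] unfolding small .
    also have "\<dots> = ennreal (C * m x)"
      using pos C by (simp add: emeasure_vmeasure_finite less_imp_le ennreal_mult)
    finally show ?thesis
      using pos[of x] C by (simp add: ennreal_le_iff)
  qed
  have "card F \<le> nat \<lceil>C * C\<rceil>" if F: "F \<subseteq> {y. E x y}" "finite F" for F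
  proof -
    have "m x / C \<le> m y" if "y \<in> F" for y
    proof -
      have "E y x"
        using F that tree unfolding is_tree_def symp_def by auto
      then have "m x \<le> C * m y"
        using bound[of "{x}" y] by simp
      then show ?thesis
        using C by (simp add: divide_le_eq mult.commute)
    qed
    then have "real (card F) * (m x / C) \<le> (\<Sum>y\<in>F. m y)"
      by (rule sum_bounded_below)
    also have "\<dots> \<le> C * m x"
      by (rule bound[OF F(2,1)])
    finally have "real (card F) \<le> C * C"
      using pos[of x] C by (simp add: field_simps)
    then show ?thesis by linarith
  qed
  then show ?thesis
    using finite_if_finite_subsets_card_bdd by blast
qed

text \<open>For \<open>y\<close> below \<open>x\<close> the distance is the drop in level, less than
  \<open>h2\<close> in a trapezoid; and only finitely many vertices are reached by a bounded number
  of steps in a locally finite graph.\<close>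

lemma finite_admissible:
  assumes tree: "is_tree E" and pos: "\<And>x. m x > 0" and doubling: "locally_doubling E m"
    and R: "R \<in> admissible E w \<beta>"
  shows "finite R"
proof -
  have "finite {y. (E ^^ n) x y}" for n x
  proof (induction n)
    case (Suc n)
    have "{y. (E ^^ Suc n) x y} = (\<Union>z\<in>{z. (E ^^ n) x z}. {y. E z y})"
      by auto
    then show ?case
      using Suc finite_neighbours[OF tree pos doubling] by simp
  qed simp
  then have fin: "finite (\<Union>n\<le>h. {y. (E ^^ n) x y})" for h x
    by blast
  have "finite (trapezoid E w h1 h2 x)" for h1 h2 x
  proof (rule finite_subset[OF _ fin])
    show "trapezoid E w h1 h2 x \<subseteq> (\<Union>n\<le>h2. {y. (E ^^ n) x y})"
    proof
      fix y assume "y \<in> trapezoid E w h1 h2 x"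
      then have "gdist E x y \<le> h2"
        unfolding trapezoid_def below_def by auto
      moreover have "(E ^^ gdist E x y) x y"
        using tree unfolding is_tree_def by (intro relpowp_gdist) auto
      ultimately show "y \<in> (\<Union>n\<le>h2. {y. (E ^^ n) x y})" by auto
    qed
  qed
  then show ?thesis
    using R unfolding admissible_def by auto
qed

text \<open>The tree and the doubling condition enter the analysis through the last two assumptions:
  finiteness turns integrals into sums, and common admissible sets connect the values of a function
  at different vertices.\<close>

locale hardy =
  fixes E :: "'v \<Rightarrow> 'v \<Rightarrow> bool" and w :: "nat \<Rightarrow> 'v" and m :: "'v \<Rightarrow> real" and \<beta> :: real
  assumes m_pos: "m x > 0"
    and finite_adm: "R \<in> admissible E w \<beta> \<Longrightarrow> finite R"
    and common_adm: "\<exists>R\<in>admissible E w \<beta>. x \<in> R \<and> y \<in> R"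
begin

lemma m_nonneg: "m x \<ge> 0"
  using m_pos by (rule less_imp_le)

definition mass :: "'v set \<Rightarrow> real" where
  "mass R = (\<Sum>x\<in>R. m x)"

lemma mass_pos: "finite R \<Longrightarrow> R \<noteq> {} \<Longrightarrow> mass R > 0"
  unfolding mass_def using m_pos by (intro sum_pos) auto

lemma mass_nonneg: "mass R \<ge> 0"
  unfolding mass_def using m_nonneg by (intro sum_nonneg)

lemma mean_on_finite:
  assumes "finite R"
  shows "mean_on m f R = (\<Sum>x\<in>R. m x *\<^sub>R f x) / of_real (mass R)"
  unfolding mean_on_def mass_def using assms m_nonneg
  by (simp add: measure_vmeasure_finite set_integral_vmeasure_finite)

lemma mean_osc_finite:
  assumes "finite R"
  shows "mean_osc m f R = (\<Sum>x\<in>R. m x * cmod (f x - mean_on m f R)) / mass R"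
  unfolding mean_osc_def mass_def using assms m_nonneg
  by (simp add: measure_vmeasure_finite set_integral_vmeasure_finite)

lemma mean_osc_nonneg: "R \<in> admissible E w \<beta> \<Longrightarrow> mean_osc m f R \<ge> 0"
  using finite_adm mass_nonneg m_nonneg
  by (auto simp: mean_osc_finite intro!: divide_nonneg_nonneg sum_nonneg)

lemma admissible_nonempty: "admissible E w \<beta> \<noteq> {}"
  using common_adm by blast

lemma mean_osc_le_BMO_norm:
  assumes "f \<in> BMO E w m \<beta>" "R \<in> admissible E w \<beta>"
  shows "mean_osc m f R \<le> BMO_norm E w m \<beta> f"
  using assms unfolding BMO_def BMO_norm_def by (auto intro: cSUP_upper)

lemma BMO_norm_nonneg:
  assumes "f \<in> BMO E w m \<beta>"
  shows "BMO_norm E w m \<beta> f \<ge> 0"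
  using admissible_nonempty mean_osc_nonneg mean_osc_le_BMO_norm[OF assms] by (meson all_not_in_conv order_trans)

lemma atom_iff:
  "atom E w m \<beta> a \<longleftrightarrow> (\<exists>R\<in>admissible E w \<beta>. (\<forall>x. x \<notin> R \<longrightarrow> a x = 0) \<and>
      (\<forall>x. cmod (a x) \<le> inverse (mass R)) \<and> (\<Sum>x\<in>R. m x *\<^sub>R a x) = 0)"
  unfolding atom_def mass_def using finite_adm m_nonneg
  by (intro bex_cong) (auto simp: measure_vmeasure_finite set_integral_vmeasure_finite)

lemma atom_zero: "atom E w m \<beta> (\<lambda>_. 0)"
  unfolding atom_iff using admissible_nonempty mass_nonneg by auto

lemma atom_finite_support:
  assumes "atom E w m \<beta> a"
  shows "finite {x. a x \<noteq> 0}"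
proof -
  obtain R where "R \<in> admissible E w \<beta>" "\<forall>x. x \<notin> R \<longrightarrow> a x = 0"
    using assms unfolding atom_iff by blast
  then show ?thesis
    using finite_subset[OF _ finite_adm, of "{x. a x \<noteq> 0}"] by auto
qed

lemma finite_support_sum:
  fixes n :: nat
  assumes "\<And>j. j < n \<Longrightarrow> atom E w m \<beta> (a j)"
  shows "finite {x. (\<Sum>j<n. c j * a j x) \<noteq> (0::complex)}"
proof (rule finite_subset)
  have "finite {x. a j x \<noteq> 0}" if "j < n" for j
    by (rule atom_finite_support[OF assms[OF that]])
  then show "finite (\<Union>j<n. {x. a j x \<noteq> 0})"
    by simp
  show "{x. (\<Sum>j<n. c j * a j x) \<noteq> 0} \<subseteq> (\<Union>j<n. {x. a j x \<noteq> 0})"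
    by (force intro: sum.neutral)
qed

lemma integrable_finite_support:
  fixes g :: "'v \<Rightarrow> complex"
  assumes "finite {x. g x \<noteq> 0}"
  shows "integrable (vmeasure m) g"
  using has_bochner_integral_finite_support[OF assms, of g m] m_nonneg
  by (auto simp: has_bochner_integral_iff)

lemma integrable_mult_finite_support:
  fixes f g :: "'v \<Rightarrow> complex"
  assumes "finite {x. g x \<noteq> 0}"
  shows "integrable (vmeasure m) (\<lambda>x. f x * g x)"
  by (rule integrable_finite_support) (rule finite_subset[OF _ assms], auto)

lemma integral_mult_support:
  fixes f g :: "'v \<Rightarrow> complex"
  assumes "finite R" "\<And>x. x \<notin> R \<Longrightarrow> g x = 0"
  shows "(LINT x|vmeasure m. f x * g x) = (\<Sum>x\<in>R. m x *\<^sub>R (f x * g x))"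
  using has_bochner_integral_finite_support[of R "\<lambda>x. f x * g x" m] assms m_nonneg
  by (simp add: has_bochner_integral_integral_eq)

lemma integral_mult_atomic_sum:
  fixes n :: nat
  assumes "\<And>j. j < n \<Longrightarrow> atom E w m \<beta> (a j)"
  shows "(LINT x|vmeasure m. f x * (\<Sum>j<n. c j * a j x))
    = (\<Sum>j<n. c j * (LINT x|vmeasure m. f x * a j x))"
proof -
  have "(LINT x|vmeasure m. f x * (\<Sum>j<n. c j * a j x))
      = (LINT x|vmeasure m. (\<Sum>j<n. c j * (f x * a j x)))"
    by (simp add: sum_distrib_left mult.left_commute)
  also have "\<dots> = (\<Sum>j<n. LINT x|vmeasure m. c j * (f x * a j x))"
    using integrable_mult_finite_support[OF atom_finite_support[OF assms]]
    by (intro Bochner_Integration.integral_sum) auto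
  finally show ?thesis by simp
qed

section \<open>Atomic decompositions\<close>

lemma H1_norm_le:
  assumes "atomic_decomp E w m \<beta> g c a"
  shows "H1_norm E w m \<beta> g \<le> (\<Sum>j. cmod (c j))"
  unfolding H1_norm_def
proof (rule cInf_lower)
  show "bdd_below {(\<Sum>j. cmod (c j)) |c a. atomic_decomp E w m \<beta> g c a}"
    by (rule bdd_belowI[of _ 0]) (auto simp: atomic_decomp_def intro: suminf_nonneg)
qed (use assms in blast)

lemma near_optimal_decomp:
  assumes "g \<in> H1 E w m \<beta>" "H1_norm E w m \<beta> g < s"
  obtains c a where "atomic_decomp E w m \<beta> g c a" "(\<Sum>j. cmod (c j)) < s"
proof -
  let ?X = "{(\<Sum>j. cmod (c j)) |c a. atomic_decomp E w m \<beta> g c a}"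
  have "?X \<noteq> {}"
    using assms(1) unfolding H1_def by blast
  then obtain t where "t \<in> ?X" "t < s"
    using assms(2) unfolding H1_norm_def by (meson cInf_lessD)
  then show thesis using that by blast
qed

lemma H1_norm_nonneg:
  assumes "g \<in> H1 E w m \<beta>"
  shows "H1_norm E w m \<beta> g \<ge> 0"
proof (rule ccontr)
  assume "\<not> 0 \<le> H1_norm E w m \<beta> g"
  then obtain c a where "atomic_decomp E w m \<beta> g c a" "(\<Sum>j. cmod (c j)) < 0"
    using near_optimal_decomp[OF assms, of 0] by auto
  then show False
    using suminf_nonneg[of "\<lambda>j. cmod (c j)"] unfolding atomic_decomp_def by auto
qed

text \<open>Padding by zero atoms with zero coefficients makes the partial sums stationary from
  \<open>n\<close> on.\<close>

lemma atomic_decomp_finite: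
  assumes "\<And>j. j < n \<Longrightarrow> atom E w m \<beta> (a j)"
  shows "atomic_decomp E w m \<beta> (\<lambda>x. \<Sum>j<n. c j * a j x)
      (\<lambda>j. if j < n then c j else 0) (\<lambda>j. if j < n then a j else (\<lambda>_. 0))"
proof -
  have "(\<Sum>j<k. (if j < n then c j else 0) * (if j < n then a j else (\<lambda>_. 0)) x)
      = (\<Sum>j<n. c j * a j x)" if "k \<ge> n" for k x
    by (rule sum.mono_neutral_cong_right) (use that in auto)
  then have "\<forall>\<^sub>F k in sequentially. (\<integral>\<^sup>+x. ennreal (cmod ((\<Sum>j<n. c j * a j x) -
      (\<Sum>j<k. (if j < n then c j else 0) * (if j < n then a j else (\<lambda>_. 0)) x))) \<partial>vmeasure m) = 0"
    by (intro eventually_sequentiallyI[of n]) simp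
  then have "(\<lambda>k. \<integral>\<^sup>+x. ennreal (cmod ((\<Sum>j<n. c j * a j x) -
      (\<Sum>j<k. (if j < n then c j else 0) * (if j < n then a j else (\<lambda>_. 0)) x))) \<partial>vmeasure m) \<longlonglongrightarrow> 0"
    by (rule tendsto_eventually)
  moreover have "summable (\<lambda>j. cmod (if j < n then c j else 0))"
    by (rule summable_finite[of "{..<n}"]) auto
  ultimately show ?thesis
    unfolding atomic_decomp_def using assms atom_zero by auto
qed

lemma H1_fin_subset: "H1_fin E w m \<beta> \<subseteq> H1 E w m \<beta>"
proof
  fix g assume "g \<in> H1_fin E w m \<beta>"
  then obtain n :: nat and c a where a: "\<And>j. j < n \<Longrightarrow> atom E w m \<beta> (a j)"
    and g: "g = (\<lambda>x. \<Sum>j<n. c j * a j x)"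
    unfolding H1_fin_def by blast
  have "integrable (vmeasure m) g"
    unfolding g by (rule integrable_finite_support) (rule finite_support_sum[OF a])
  then show "g \<in> H1 E w m \<beta>"
    unfolding H1_def using atomic_decomp_finite[where n = n and a = a and c = c] a g by blast
qed

lemma H1_fin_finite_support:
  assumes "g \<in> H1_fin E w m \<beta>"
  shows "finite {x. g x \<noteq> 0}"
  using assms finite_support_sum unfolding H1_fin_def by force

lemma atom_in_H1_fin:
  assumes "atom E w m \<beta> a"
  shows "a \<in> H1_fin E w m \<beta>" "H1_norm E w m \<beta> a \<le> 1"
proof -
  have eq: "a = (\<lambda>x. \<Sum>j<(1::nat). 1 * a x)"
    by simp
  then show "a \<in> H1_fin E w m \<beta>"
    unfolding H1_fin_def using assms
    by (intro CollectI exI[of _ 1] exI[of _ "\<lambda>_. 1"] exI[of _ "\<lambda>_. a"]) auto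
  have "H1_norm E w m \<beta> a \<le> (\<Sum>j. cmod (if j < 1 then 1 else 0))"
    using H1_norm_le[OF atomic_decomp_finite[of 1 "\<lambda>_. a" "\<lambda>_. 1"]] assms eq by simp
  also have "\<dots> = (\<Sum>j\<in>{..<1::nat}. cmod (if j < 1 then 1 else 0))"
    by (rule suminf_finite) auto
  finally show "H1_norm E w m \<beta> a \<le> 1" by simp
qed

lemma H1_fin_add:
  assumes "g \<in> H1_fin E w m \<beta>" "h \<in> H1_fin E w m \<beta>"
  shows "(\<lambda>x. g x + h x) \<in> H1_fin E w m \<beta>"
proof -
  obtain n :: nat and c a where a: "\<And>j. j < n \<Longrightarrow> atom E w m \<beta> (a j)"
    and g: "g = (\<lambda>x. \<Sum>j<n. c j * a j x)"
    using assms(1) unfolding H1_fin_def by blast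
  obtain n' :: nat and c' a' where a': "\<And>j. j < n' \<Longrightarrow> atom E w m \<beta> (a' j)"
    and h: "h = (\<lambda>x. \<Sum>j<n'. c' j * a' j x)"
    using assms(2) unfolding H1_fin_def by blast
  define d where "d j = (if j < n then c j else c' (j - n))" for j
  define b where "b j = (if j < n then a j else a' (j - n))" for j
  have "g x + h x = (\<Sum>j<n + n'. d j * b j x)" for x
  proof -
    have "(\<Sum>j<n + k. d j * b j x) = (\<Sum>j<n. c j * a j x) + (\<Sum>j<k. c' j * a' j x)" for k
      by (induction k) (simp_all add: d_def b_def)
    then show ?thesis unfolding g h by simp
  qed
  moreover have "atom E w m \<beta> (b j)" if "j < n + n'" for j
    using a a' that unfolding b_def by auto
  ultimately show ?thesis
    unfolding H1_fin_def by blast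
qed

lemma H1_fin_scale:
  assumes "g \<in> H1_fin E w m \<beta>"
  shows "(\<lambda>x. k * g x) \<in> H1_fin E w m \<beta>"
proof -
  obtain n :: nat and c a where a: "\<forall>j<n. atom E w m \<beta> (a j)"
    and g: "g = (\<lambda>x. \<Sum>j<n. c j * a j x)"
    using assms unfolding H1_fin_def by blast
  have "(\<lambda>x. k * g x) = (\<lambda>x. \<Sum>j<n. (k * c j) * a j x)"
    unfolding g by (simp add: sum_distrib_left mult.assoc)
  with a show ?thesis
    unfolding H1_fin_def by (intro CollectI exI[of _ n] exI[of _ "\<lambda>j. k * c j"] exI[of _ a] conjI)
qed

lemma zero_in_H1_fin: "(\<lambda>_. 0) \<in> H1_fin E w m \<beta>"
  using atom_in_H1_fin(1)[OF atom_zero] .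

lemma atomic_decomp_scale:
  assumes "atomic_decomp E w m \<beta> g c a"
  shows "atomic_decomp E w m \<beta> (\<lambda>x. k * g x) (\<lambda>j. k * c j) a"
proof -
  have eq: "(\<integral>\<^sup>+x. ennreal (cmod (k * g x - (\<Sum>j<n. k * c j * a j x))) \<partial>vmeasure m)
      = ennreal (cmod k) * (\<integral>\<^sup>+x. ennreal (cmod (g x - (\<Sum>j<n. c j * a j x))) \<partial>vmeasure m)" for n
  proof -
    have "k * g x - (\<Sum>j<n. k * c j * a j x) = k * (g x - (\<Sum>j<n. c j * a j x))" for x
      by (simp add: sum_distrib_left mult.assoc right_diff_distrib)
    then show ?thesis
      by (simp add: norm_mult ennreal_mult nn_integral_cmult)
  qed
  have "(\<lambda>n. ennreal (cmod k) * (\<integral>\<^sup>+x. ennreal (cmod (g x - (\<Sum>j<n. c j * a j x))) \<partial>vmeasure m))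
      \<longlonglongrightarrow> ennreal (cmod k) * 0"
    using assms unfolding atomic_decomp_def by (intro ennreal_tendsto_cmult) auto
  then show ?thesis
    using assms unfolding atomic_decomp_def eq by (simp add: norm_mult summable_mult)
qed

lemma H1_scale:
  assumes "g \<in> H1 E w m \<beta>"
  shows "(\<lambda>x. k * g x) \<in> H1 E w m \<beta>"
  using assms atomic_decomp_scale[of g _ _ k] unfolding H1_def by auto

lemma H1_norm_scale:
  assumes g: "g \<in> H1 E w m \<beta>"
  shows "H1_norm E w m \<beta> (\<lambda>x. k * g x) \<le> cmod k * H1_norm E w m \<beta> g"
proof (rule field_le_epsilon)
  fix e :: real assume "e > 0"
  \<comment> \<open>The \<open>+ 1\<close> keeps \<open>d\<close> defined and positive when
    \<open>k = 0\<close>. The slack is there because the infimum in \<open>H1_norm\<close> need not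
    be attained.\<close>
  define d where "d = e / (cmod k + 1)"
  have pos: "cmod k + 1 > 0"
    by (simp add: add_nonneg_pos)
  then have d: "d > 0" "cmod k * d \<le> e"
    using \<open>e > 0\<close> unfolding d_def times_divide_eq_right pos_divide_le_eq[OF pos]
    by (simp_all add: distrib_left mult.commute)
  obtain c a where dec: "atomic_decomp E w m \<beta> g c a" "(\<Sum>j. cmod (c j)) < H1_norm E w m \<beta> g + d"
    using near_optimal_decomp[OF g, of "H1_norm E w m \<beta> g + d"] d by auto
  have "H1_norm E w m \<beta> (\<lambda>x. k * g x) \<le> (\<Sum>j. cmod (k * c j))"
    by (rule H1_norm_le[OF atomic_decomp_scale[OF dec(1)]])
  also have "\<dots> = cmod k * (\<Sum>j. cmod (c j))"
    using dec(1) unfolding atomic_decomp_def by (simp add: norm_mult suminf_mult)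
  also have "\<dots> \<le> cmod k * (H1_norm E w m \<beta> g + d)"
    using dec(2) by (intro mult_left_mono) auto
  also have "\<dots> \<le> cmod k * H1_norm E w m \<beta> g + e"
    using d(2) by (simp add: distrib_left)
  finally show "H1_norm E w m \<beta> (\<lambda>x. k * g x) \<le> cmod k * H1_norm E w m \<beta> g + e" .
qed

text \<open>The shifted series is an atomic decomposition of the remainder, whose norm is therefore
  at most the tail of the coefficient sum. Density of finite combinations and the uniform smallness
  of tails both come from this.\<close>

lemma H1_diff_partial_sum:
  assumes g: "integrable (vmeasure m) g" and dec: "atomic_decomp E w m \<beta> g c a"
  shows "(\<lambda>x. \<Sum>j<n. c j * a j x) \<in> H1_fin E w m \<beta>"
    and "atomic_decomp E w m \<beta> (\<lambda>x. g x - (\<Sum>j<n. c j * a j x)) (\<lambda>j. c (j + n)) (\<lambda>j. a (j + n))"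
    and "(\<lambda>x. g x - (\<Sum>j<n. c j * a j x)) \<in> H1 E w m \<beta>"
proof -
  have a: "\<And>j. atom E w m \<beta> (a j)" and c: "summable (\<lambda>j. cmod (c j))"
    using dec unfolding atomic_decomp_def by auto
  then show "(\<lambda>x. \<Sum>j<n. c j * a j x) \<in> H1_fin E w m \<beta>"
    unfolding H1_fin_def by blast
  have eq: "(g x - (\<Sum>j<n. c j * a j x)) - (\<Sum>j<k. c (j + n) * a (j + n) x)
      = g x - (\<Sum>j<k + n. c j * a j x)" for k x
    by (induction k) (simp_all add: algebra_simps)
  have lim: "(\<lambda>k. \<integral>\<^sup>+x. ennreal (cmod (g x - (\<Sum>j<k + n. c j * a j x))) \<partial>vmeasure m) \<longlonglongrightarrow> 0"
    using dec unfolding atomic_decomp_def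
    by (intro LIMSEQ_ignore_initial_segment[where k = n]) blast
  show tail: "atomic_decomp E w m \<beta> (\<lambda>x. g x - (\<Sum>j<n. c j * a j x))
      (\<lambda>j. c (j + n)) (\<lambda>j. a (j + n))"
    unfolding atomic_decomp_def eq using a lim summable_ignore_initial_segment[OF c, of n] by blast
  have "integrable (vmeasure m) (\<lambda>x. g x - (\<Sum>j<n. c j * a j x))"
    by (intro Bochner_Integration.integrable_diff g integrable_finite_support finite_support_sum a)
  with tail show "(\<lambda>x. g x - (\<Sum>j<n. c j * a j x)) \<in> H1 E w m \<beta>"
    unfolding H1_def by blast
qed

lemma tail_small:
  assumes "summable (\<lambda>j. cmod (c j))" "\<epsilon> > 0"
  obtains n where "(\<Sum>j. cmod (c (j + n))) < \<epsilon>"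
proof -
  obtain N where "\<forall>n\<ge>N. norm (\<Sum>j. cmod (c (j + n))) < \<epsilon>"
    using suminf_exist_split[OF assms(2,1)] by blast
  then have "norm (\<Sum>j. cmod (c (j + N))) < \<epsilon>" by blast
  then show thesis using that[of N] by simp
qed

text \<open>Membership of the difference is recorded as well: functionals are additive and bounded
  only on elements of \<open>H1\<close>.\<close>

lemma H1_fin_dense:
  assumes "g \<in> H1 E w m \<beta>" "\<epsilon> > 0"
  obtains h where "h \<in> H1_fin E w m \<beta>" "(\<lambda>x. g x - h x) \<in> H1 E w m \<beta>"
    "H1_norm E w m \<beta> (\<lambda>x. g x - h x) < \<epsilon>"
proof -
  obtain c a where g: "integrable (vmeasure m) g" and dec: "atomic_decomp E w m \<beta> g c a"
    using assms(1) unfolding H1_def by blast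
  then obtain n where n: "(\<Sum>j. cmod (c (j + n))) < \<epsilon>"
    using tail_small assms(2) unfolding atomic_decomp_def by blast
  show thesis
  proof (rule that)
    show "H1_norm E w m \<beta> (\<lambda>x. g x - (\<Sum>j<n. c j * a j x)) < \<epsilon>"
      using H1_norm_le[OF H1_diff_partial_sum(2)[OF g dec, of n]] n by simp
  qed (rule H1_diff_partial_sum[OF g dec])+
qed

lemma
  assumes "H1_linear E w m \<beta> L" "g \<in> H1 E w m \<beta>"
  shows H1_linear_add: "h \<in> H1 E w m \<beta> \<Longrightarrow> L (\<lambda>x. g x + h x) = L g + L h"
    and H1_linear_scale: "L (\<lambda>x. k * g x) = k * L g"
  using assms unfolding H1_linear_def by simp_all

section \<open>BMO functions act on the Hardy space\<close>

text \<open>Cancellation allows subtracting any constant from \<open>F (f x)\<close>. The choice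
  \<open>F z\<close>, with \<open>z\<close> the mean of \<open>f\<close> itself, lets the
  contraction property bring the estimate back to \<open>f - z\<close>, with no loss and uniformly
  in \<open>F\<close>.\<close>

lemma integral_atom_bound:
  assumes F: "\<And>u v. dist (F u) (F v) \<le> dist u v"
    and f: "f \<in> BMO E w m \<beta>" and a: "atom E w m \<beta> a"
  shows "cmod (LINT x|vmeasure m. F (f x) * a x) \<le> BMO_norm E w m \<beta> f"
proof -
  obtain R where R: "R \<in> admissible E w \<beta>" "\<forall>x. x \<notin> R \<longrightarrow> a x = 0"
    "\<forall>x. cmod (a x) \<le> inverse (mass R)" "(\<Sum>x\<in>R. m x *\<^sub>R a x) = 0"
    using a unfolding atom_iff by blast
  have fin: "finite R" by (rule finite_adm[OF R(1)])
  define z where "z = mean_on m f R"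
  have "(LINT x|vmeasure m. F (f x) * a x) = (\<Sum>x\<in>R. m x *\<^sub>R (F (f x) * a x)) - F z * (\<Sum>x\<in>R. m x *\<^sub>R a x)"
    using integral_mult_support[OF fin, of a "\<lambda>x. F (f x)"] R(2,4) by simp
  also have "\<dots> = (\<Sum>x\<in>R. m x *\<^sub>R ((F (f x) - F z) * a x))"
    by (simp add: sum_distrib_left sum_subtractf[symmetric] algebra_simps)
  also have "cmod \<dots> \<le> (\<Sum>x\<in>R. m x * cmod (f x - z) * inverse (mass R))"
  proof (rule sum_norm_le)
    fix x assume "x \<in> R"
    have "cmod (F (f x) - F z) \<le> cmod (f x - z)"
      using F[of "f x" z] by (simp add: dist_norm)
    then have "cmod (F (f x) - F z) * cmod (a x) \<le> cmod (f x - z) * inverse (mass R)"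
      using R(3) by (intro mult_mono) auto
    then show "norm (m x *\<^sub>R ((F (f x) - F z) * a x)) \<le> m x * cmod (f x - z) * inverse (mass R)"
      using m_nonneg[of x] by (simp add: norm_mult mult_left_mono mult.assoc)
  qed
  also have "\<dots> = mean_osc m f R"
    unfolding mean_osc_finite[OF fin] z_def by (simp add: sum_distrib_right divide_inverse)
  also have "\<dots> \<le> BMO_norm E w m \<beta> f"
    by (rule mean_osc_le_BMO_norm[OF f R(1)])
  finally show ?thesis .
qed

text \<open>The sup bound \<open>B\<close> only multiplies the \<open>L^1\<close> error of the
  partial sums, which tends to 0; what survives is the bound \<open>K\<close> on atoms. This makes
  the estimate uniform over truncation levels.\<close>

lemma integral_decomp_bound:
  assumes \<phi>: "\<And>x. cmod (\<phi> x) \<le> B"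
    and atoms: "\<And>a. atom E w m \<beta> a \<Longrightarrow> cmod (LINT x|vmeasure m. \<phi> x * a x) \<le> K"
    and g: "integrable (vmeasure m) g" and dec: "atomic_decomp E w m \<beta> g c a"
  shows "cmod (LINT x|vmeasure m. \<phi> x * g x) \<le> K * (\<Sum>j. cmod (c j))"
proof -
  have a: "\<And>j. atom E w m \<beta> (a j)" and c: "summable (\<lambda>j. cmod (c j))"
    using dec unfolding atomic_decomp_def by auto
  define e where "e n = (\<integral>\<^sup>+x. ennreal (cmod (g x - (\<Sum>j<n. c j * a j x))) \<partial>vmeasure m)" for n
  have e: "e \<longlonglongrightarrow> 0"
    using dec unfolding atomic_decomp_def e_def by blast
  have K: "K \<ge> 0"
    using atoms[OF atom_zero] by simp
  have B: "B \<ge> 0"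
    using \<phi> norm_ge_zero order_trans by blast
  have "ennreal (cmod (LINT x|vmeasure m. \<phi> x * g x))
      \<le> ennreal B * e n + ennreal (K * (\<Sum>j. cmod (c j)))" for n
  proof -
    let ?S = "\<lambda>x. \<Sum>j<n. c j * a j x"
    have S: "integrable (vmeasure m) ?S"
      by (intro integrable_finite_support finite_support_sum a)
    have split: "(LINT x|vmeasure m. \<phi> x * g x)
        = (LINT x|vmeasure m. \<phi> x * (g x - ?S x)) + (LINT x|vmeasure m. \<phi> x * ?S x)"
      using integrable_bounded_mult[where \<phi> = \<phi>, OF \<phi> Bochner_Integration.integrable_diff[OF g S]]
        integrable_bounded_mult[where \<phi> = \<phi>, OF \<phi> S]
      by (subst Bochner_Integration.integral_add[symmetric]) (simp_all add: algebra_simps)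
    have "ennreal (cmod (LINT x|vmeasure m. \<phi> x * (g x - ?S x)))
        \<le> (\<integral>\<^sup>+x. ennreal (cmod (\<phi> x * (g x - ?S x))) \<partial>vmeasure m)"
      by (intro integral_norm_bound_ennreal integrable_bounded_mult[OF \<phi>]
          Bochner_Integration.integrable_diff g S)
    also have "\<dots> \<le> (\<integral>\<^sup>+x. ennreal B * ennreal (cmod (g x - ?S x)) \<partial>vmeasure m)"
      using \<phi> B by (intro nn_integral_mono)
        (simp add: norm_mult ennreal_mult[symmetric] mult_right_mono)
    also have "\<dots> = ennreal B * e n"
      unfolding e_def by (rule nn_integral_cmult) simp
    finally have 1: "ennreal (cmod (LINT x|vmeasure m. \<phi> x * (g x - ?S x))) \<le> ennreal B * e n" .
    have "cmod (LINT x|vmeasure m. \<phi> x * ?S x) \<le> (\<Sum>j<n. K * cmod (c j))"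
      unfolding integral_mult_atomic_sum[OF a]
      using atoms[OF a]
      by (intro sum_norm_le) (simp add: norm_mult mult.commute[of K] mult_left_mono)
    also have "\<dots> \<le> K * (\<Sum>j. cmod (c j))"
      using K c by (simp add: sum_distrib_left[symmetric] mult_left_mono sum_le_suminf)
    finally have 2: "cmod (LINT x|vmeasure m. \<phi> x * ?S x) \<le> K * (\<Sum>j. cmod (c j))" .
    have "ennreal (cmod (LINT x|vmeasure m. \<phi> x * g x))
        \<le> ennreal (cmod (LINT x|vmeasure m. \<phi> x * (g x - ?S x)))
          + ennreal (cmod (LINT x|vmeasure m. \<phi> x * ?S x))"
      unfolding split by (simp add: ennreal_plus[symmetric] norm_triangle_ineq del: ennreal_plus)
    also have "\<dots> \<le> ennreal B * e n + ennreal (K * (\<Sum>j. cmod (c j)))"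
      using 1 2 by (intro add_mono ennreal_leI)
    finally show ?thesis .
  qed
  moreover have "(\<lambda>n. ennreal B * e n + ennreal (K * (\<Sum>j. cmod (c j))))
      \<longlonglongrightarrow> ennreal B * 0 + ennreal (K * (\<Sum>j. cmod (c j)))"
    by (intro tendsto_add ennreal_tendsto_cmult e tendsto_const) simp
  ultimately have "ennreal (cmod (LINT x|vmeasure m. \<phi> x * g x)) \<le> ennreal (K * (\<Sum>j. cmod (c j)))"
    using LIMSEQ_le_const by fastforce
  moreover have "K * (\<Sum>j. cmod (c j)) \<ge> 0"
    using K suminf_nonneg[OF c] by simp
  ultimately show ?thesis by simp
qed

text \<open>The integral of \<open>fg\<close> need not converge for \<open>g\<close> in the Hardy space, so \<open>f\<close> is truncated by
  the projection onto a disc. The projection is a contraction, whence the bound on atoms is the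
  same for all truncations.\<close>

definition trunc :: "nat \<Rightarrow> complex \<Rightarrow> complex" where
  "trunc N = closest_point (cball 0 (real N))"

lemma trunc_lipschitz: "dist (trunc N u) (trunc N v) \<le> dist u v"
  unfolding trunc_def by (rule closest_point_lipschitz) auto

lemma cmod_trunc_le: "cmod (trunc N u) \<le> real N"
  using closest_point_in_set[of "cball 0 (real N)" u] unfolding trunc_def by simp

lemma trunc_eq: "cmod u \<le> real N \<Longrightarrow> trunc N u = u"
  unfolding trunc_def by (rule closest_point_self) simp

definition truncated :: "('v \<Rightarrow> complex) \<Rightarrow> ('v \<Rightarrow> complex) \<Rightarrow> nat \<Rightarrow> complex" where
  "truncated f g N = (LINT x|vmeasure m. trunc N (f x) * g x)"

lemma truncated_bound:
  assumes "f \<in> BMO E w m \<beta>" "integrable (vmeasure m) g" "atomic_decomp E w m \<beta> g c a"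
  shows "cmod (truncated f g N) \<le> BMO_norm E w m \<beta> f * (\<Sum>j. cmod (c j))"
  unfolding truncated_def
  using cmod_trunc_le integral_atom_bound[OF trunc_lipschitz assms(1)] assms(2,3)
  by (rule integral_decomp_bound)

lemma truncated_add:
  assumes "integrable (vmeasure m) g" "integrable (vmeasure m) h"
  shows "truncated f (\<lambda>x. g x + h x) N = truncated f g N + truncated f h N"
  unfolding truncated_def distrib_left
  by (intro Bochner_Integration.integral_add integrable_bounded_mult[OF cmod_trunc_le] assms)

lemma truncated_scale: "truncated f (\<lambda>x. k * g x) N = k * truncated f g N"
  unfolding truncated_def by (simp add: mult.left_commute)

text \<open>On the finite support of \<open>g\<close> the function \<open>f\<close> is bounded, so
  high truncations leave it unchanged there.\<close>

lemma truncated_eventually_eq: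
  assumes "finite {x. g x \<noteq> 0}"
  obtains N where "\<And>n. n \<ge> N \<Longrightarrow> truncated f g n = (LINT x|vmeasure m. f x * g x)"
proof -
  obtain N where N: "\<forall>x\<in>{x. g x \<noteq> 0}. cmod (f x) \<le> real N"
  proof -
    have "bdd_above (cmod ` f ` {x. g x \<noteq> 0})"
      using assms by (intro bdd_above_finite) auto
    then obtain b where "\<forall>x\<in>{x. g x \<noteq> 0}. cmod (f x) \<le> b"
      unfolding bdd_above_def by auto
    then show thesis
      using that real_arch_simple[of b] by (meson order_trans)
  qed
  have eq: "trunc n (f x) * g x = f x * g x" if "n \<ge> N" for n x
  proof (cases "g x = 0")
    case False
    then have "cmod (f x) \<le> real N"
      using N by simp
    then show ?thesis
      using that by (simp add: trunc_eq)
  qed simp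
  show thesis
    by (rule that[of N]) (simp add: truncated_def eq)
qed

text \<open>Cut a decomposition of \<open>g\<close> so late that the tail contributes less than
  \<open>e / 2\<close> at every truncation level. The remaining finite sum has finite support, so
  its pairing is eventually constant and cancels in differences.\<close>

lemma truncated_convergent:
  assumes f: "f \<in> BMO E w m \<beta>" and "g \<in> H1 E w m \<beta>"
  shows "convergent (truncated f g)"
proof -
  obtain c a where g: "integrable (vmeasure m) g" and dec: "atomic_decomp E w m \<beta> g c a"
    using assms(2) unfolding H1_def by blast
  have c: "summable (\<lambda>j. cmod (c j))"
    using dec unfolding atomic_decomp_def by blast
  define K where "K = BMO_norm E w m \<beta> f"
  have K: "K \<ge> 0"
    unfolding K_def by (rule BMO_norm_nonneg[OF f])
  have "Cauchy (truncated f g)"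
  proof (rule CauchyI)
    fix e :: real assume "e > 0"
    \<comment> \<open>Using \<open>K + 1\<close> covers \<open>K = 0\<close> and makes
      \<open>K\<close> times this quotient strictly smaller than \<open>e / 2\<close>.\<close>
    then have "e / (2 * (K + 1)) > 0"
      using K by simp
    then obtain n where n: "(\<Sum>j. cmod (c (j + n))) < e / (2 * (K + 1))"
      using tail_small[OF c] by blast
    let ?S = "\<lambda>x. \<Sum>j<n. c j * a j x"
    let ?h = "\<lambda>x. g x - ?S x"
    note h = H1_diff_partial_sum[OF g dec, of n]
    have fin: "finite {x. ?S x \<noteq> 0}"
      by (rule H1_fin_finite_support[OF h(1)])
    obtain N where N: "\<And>k. k \<ge> N \<Longrightarrow> truncated f ?S k = (LINT x|vmeasure m. f x * ?S x)"
      using truncated_eventually_eq[OF fin] by blast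
    have hint: "integrable (vmeasure m) ?h"
      using h(3) unfolding H1_def by blast
    have small: "cmod (truncated f ?h k) < e / 2" for k
    proof -
      have "cmod (truncated f ?h k) \<le> K * (\<Sum>j. cmod (c (j + n)))"
        unfolding K_def by (rule truncated_bound[OF f hint h(2)])
      also have "\<dots> \<le> K * (e / (2 * (K + 1)))"
        using n K by (intro mult_left_mono) auto
      also have "\<dots> < e / 2"
        using \<open>e > 0\<close> K by (simp add: field_simps)
      finally show ?thesis .
    qed
    have split: "truncated f g k = truncated f ?h k + truncated f ?S k" for k
      using truncated_add[OF hint integrable_finite_support[OF fin]] by simp
    show "\<exists>M. \<forall>k\<ge>M. \<forall>l\<ge>M. norm (truncated f g k - truncated f g l) < e"
    proof (intro exI[of _ N] allI impI)
      fix k l assume "N \<le> k" "N \<le> l"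
      then have "truncated f g k - truncated f g l = truncated f ?h k - truncated f ?h l"
        using split[of k] split[of l] N[of k] N[of l] by simp
      moreover have "cmod (u - v) < e" if "cmod u < e / 2" "cmod v < e / 2" for u v
        using norm_triangle_ineq4[of u v] that by linarith
      ultimately show "norm (truncated f g k - truncated f g l) < e"
        using small by (simp only:)
    qed
  qed
  then show ?thesis
    by (rule Cauchy_convergent)
qed

section \<open>The extended functional as a limit of truncated integrals, its norm and its
  uniqueness\<close>

definition pairing :: "('v \<Rightarrow> complex) \<Rightarrow> ('v \<Rightarrow> complex) \<Rightarrow> complex" where
  "pairing f g = lim (truncated f g)"

lemma pairing_limit:
  "f \<in> BMO E w m \<beta> \<Longrightarrow> g \<in> H1 E w m \<beta> \<Longrightarrow> truncated f g \<longlonglongrightarrow> pairing f g"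
  unfolding pairing_def by (rule convergent_LIMSEQ_iff[THEN iffD1, OF truncated_convergent])

lemma pairing_bound:
  assumes f: "f \<in> BMO E w m \<beta>" and g: "g \<in> H1 E w m \<beta>"
  shows "cmod (pairing f g) \<le> BMO_norm E w m \<beta> f * H1_norm E w m \<beta> g"
proof (rule field_le_epsilon)
  fix e :: real assume "e > 0"
  let ?K = "BMO_norm E w m \<beta> f"
  \<comment> \<open>A decomposition within \<open>d\<close> of the infimum costs at most
    \<open>?K * d \<le> e\<close>; the \<open>+ 1\<close> admits \<open>?K = 0\<close>.\<close>
  define d where "d = e / (?K + 1)"
  have K: "?K \<ge> 0" by (rule BMO_norm_nonneg[OF f])
  have pos: "?K + 1 > 0"
    using K by simp
  then have d: "d > 0" "?K * d \<le> e"
    using \<open>e > 0\<close> unfolding d_def times_divide_eq_right pos_divide_le_eq[OF pos]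
    by (simp_all add: distrib_left mult.commute)
  obtain c a where dec: "atomic_decomp E w m \<beta> g c a" "(\<Sum>j. cmod (c j)) < H1_norm E w m \<beta> g + d"
    using near_optimal_decomp[OF g, of "H1_norm E w m \<beta> g + d"] d by auto
  have int: "integrable (vmeasure m) g"
    using g unfolding H1_def by blast
  have "cmod (pairing f g) \<le> ?K * (\<Sum>j. cmod (c j))"
    using tendsto_norm[OF pairing_limit[OF f g]] truncated_bound[OF f int dec(1)]
    by (intro LIMSEQ_le_const2) auto
  also have "\<dots> \<le> ?K * (H1_norm E w m \<beta> g + d)"
    using dec(2) K by (intro mult_left_mono) auto
  also have "\<dots> \<le> ?K * H1_norm E w m \<beta> g + e"
    using d(2) by (simp add: distrib_left)
  finally show "cmod (pairing f g) \<le> ?K * H1_norm E w m \<beta> g + e" .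
qed

lemma pairing_add:
  assumes f: "f \<in> BMO E w m \<beta>" and g: "g \<in> H1 E w m \<beta>" and h: "h \<in> H1 E w m \<beta>"
  shows "pairing f (\<lambda>x. g x + h x) = pairing f g + pairing f h"
proof -
  have "truncated f (\<lambda>x. g x + h x) = (\<lambda>N. truncated f g N + truncated f h N)"
    using g h unfolding H1_def by (intro ext truncated_add) auto
  then have "truncated f (\<lambda>x. g x + h x) \<longlonglongrightarrow> pairing f g + pairing f h"
    using tendsto_add[OF pairing_limit[OF f g] pairing_limit[OF f h]] by simp
  then show ?thesis
    unfolding pairing_def[of f "\<lambda>x. g x + h x"] by (rule limI)
qed

lemma pairing_scale:
  assumes f: "f \<in> BMO E w m \<beta>" and g: "g \<in> H1 E w m \<beta>"
  shows "pairing f (\<lambda>x. k * g x) = k * pairing f g"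
proof -
  have "truncated f (\<lambda>x. k * g x) \<longlonglongrightarrow> k * pairing f g"
    using tendsto_mult_left[OF pairing_limit[OF f g], of k]
    by (simp add: truncated_scale[abs_def])
  then show ?thesis
    unfolding pairing_def[of f "\<lambda>x. k * g x"] by (rule limI)
qed

lemma pairing_H1_fin:
  assumes "g \<in> H1_fin E w m \<beta>"
  shows "pairing f g = (LINT x|vmeasure m. f x * g x)"
proof -
  obtain N where "\<And>n. n \<ge> N \<Longrightarrow> truncated f g n = (LINT x|vmeasure m. f x * g x)"
    using truncated_eventually_eq[OF H1_fin_finite_support[OF assms]] by blast
  then have "truncated f g \<longlonglongrightarrow> (LINT x|vmeasure m. f x * g x)"
    by (intro tendsto_eventually eventually_sequentiallyI)
  then show ?thesis
    unfolding pairing_def by (rule limI)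
qed

lemma bounded_extension_pairing:
  assumes "f \<in> BMO E w m \<beta>"
  shows "bounded_extension E w m \<beta> f (pairing f)"
  unfolding bounded_extension_def H1_linear_def H1_bounded_def
proof (intro conjI ballI allI exI)
  fix g assume g: "g \<in> H1_fin E w m \<beta>"
  show "integrable (vmeasure m) (\<lambda>x. f x * g x)"
    by (intro integrable_mult_finite_support H1_fin_finite_support g)
  show "pairing f g = (LINT x|vmeasure m. f x * g x)"
    by (rule pairing_H1_fin[OF g])
qed (rule pairing_add pairing_scale pairing_bound assms | assumption)+

text \<open>Split \<open>g\<close> as \<open>(g - h) + h\<close> with \<open>h\<close> a finite
  combination of atoms: the two functionals agree on \<open>h\<close> and both are small on
  \<open>g - h\<close>.\<close>

lemma bounded_extension_unique:
  assumes L: "bounded_extension E w m \<beta> f L" and L': "bounded_extension E w m \<beta> f L'"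
    and g: "g \<in> H1 E w m \<beta>"
  shows "L' g = L g"
proof -
  obtain B where B: "\<And>g. g \<in> H1 E w m \<beta> \<Longrightarrow> cmod (L g) \<le> B * H1_norm E w m \<beta> g"
    using L unfolding bounded_extension_def H1_bounded_def by blast
  obtain B' where B': "\<And>g. g \<in> H1 E w m \<beta> \<Longrightarrow> cmod (L' g) \<le> B' * H1_norm E w m \<beta> g"
    using L' unfolding bounded_extension_def H1_bounded_def by blast
  \<comment> \<open>\<open>H1_bounded\<close> imposes no sign on its constant, hence the absolute
    values; the \<open>+ 1\<close> permits division by \<open>K\<close>.\<close>
  define K where "K = \<bar>B\<bar> + \<bar>B'\<bar> + 1"
  have K: "K > 0" unfolding K_def by simp
  have "cmod (L' g - L g) \<le> 0 + e" if e: "e > 0" for e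
  proof -
    obtain h where h: "h \<in> H1_fin E w m \<beta>" "(\<lambda>x. g x - h x) \<in> H1 E w m \<beta>"
      "H1_norm E w m \<beta> (\<lambda>x. g x - h x) < e / K"
      using H1_fin_dense[OF g divide_pos_pos[OF e K]] by blast
    let ?d = "\<lambda>x. g x - h x"
    have hH: "h \<in> H1 E w m \<beta>"
      using h(1) H1_fin_subset by blast
    have add: "P (\<lambda>x. ?d x + h x) = P ?d + P h" if "H1_linear E w m \<beta> P" for P
      by (rule H1_linear_add[OF that h(2) hH])
    have "L g = L ?d + L h" "L' g = L' ?d + L' h"
      using add[of L] add[of L'] L L' unfolding bounded_extension_def by simp_all
    moreover have "L h = L' h"
      using L L' h(1) unfolding bounded_extension_def by simp
    ultimately have "cmod (L' g - L g) \<le> cmod (L' ?d) + cmod (L ?d)"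
      using norm_triangle_ineq4[of "L' ?d" "L ?d"] by simp
    also have "\<dots> \<le> B' * H1_norm E w m \<beta> ?d + B * H1_norm E w m \<beta> ?d"
      using B[OF h(2)] B'[OF h(2)] by simp
    also have "\<dots> = (B' + B) * H1_norm E w m \<beta> ?d"
      by (simp add: distrib_right)
    also have "\<dots> \<le> K * H1_norm E w m \<beta> ?d"
      using H1_norm_nonneg[OF h(2)] unfolding K_def by (intro mult_right_mono) auto
    also have "\<dots> \<le> K * (e / K)"
      using h(3) K by (intro mult_left_mono) auto
    finally show ?thesis using K by simp
  qed
  then have "cmod (L' g - L g) \<le> 0"
    by (rule field_le_epsilon)
  then show ?thesis by simp
qed

lemma H1_dual_norm_pairing_le:
  assumes f: "f \<in> BMO E w m \<beta>"
  shows "H1_dual_norm E w m \<beta> (pairing f) \<le> BMO_norm E w m \<beta> f"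
  unfolding H1_dual_norm_def
proof (rule cSup_least)
  show "{cmod (pairing f g) |g. g \<in> H1 E w m \<beta> \<and> H1_norm E w m \<beta> g \<le> 1} \<noteq> {}"
    using atom_in_H1_fin[OF atom_zero] H1_fin_subset by blast
  fix t assume "t \<in> {cmod (pairing f g) |g. g \<in> H1 E w m \<beta> \<and> H1_norm E w m \<beta> g \<le> 1}"
  then obtain g where g: "g \<in> H1 E w m \<beta>" "H1_norm E w m \<beta> g \<le> 1" "t = cmod (pairing f g)"
    by blast
  then show "t \<le> BMO_norm E w m \<beta> f"
    using pairing_bound[OF f g(1)] mult_left_mono[OF g(2) BMO_norm_nonneg[OF f]] by simp
qed

section \<open>Representation of continuous functionals\<close>

text \<open>Continuity at 0 yields a ball of radius \<open>\<delta>\<close> on which the values stay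
  below 1; homogeneity carries this to every \<open>g\<close>, rescaled to norm at most
  \<open>\<delta> / 2\<close>.\<close>

lemma H1_continuous_imp_bounded:
  assumes lin: "H1_linear E w m \<beta> L" and cont: "H1_continuous E w m \<beta> L"
  obtains B where "B \<ge> 0" "\<And>g. g \<in> H1 E w m \<beta> \<Longrightarrow> cmod (L g) \<le> B * H1_norm E w m \<beta> g"
proof -
  have zero: "(\<lambda>_. 0) \<in> H1 E w m \<beta>"
    using zero_in_H1_fin H1_fin_subset by blast
  have scale: "L (\<lambda>x. k * g x) = k * L g" if "g \<in> H1 E w m \<beta>" for k g
    by (rule H1_linear_scale[OF lin that])
  have L0: "L (\<lambda>_. 0) = 0"
    using scale[OF zero, of 0] by simp
  have "\<forall>\<epsilon>>0. \<exists>\<delta>>0. \<forall>h\<in>H1 E w m \<beta>.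
      H1_norm E w m \<beta> (\<lambda>x. h x - 0) < \<delta> \<longrightarrow> cmod (L h - L (\<lambda>_. 0)) < \<epsilon>"
    using cont unfolding H1_continuous_def by (rule bspec[OF _ zero])
  from this[rule_format, OF zero_less_one] obtain \<delta> where \<delta>: "\<delta> > 0" "\<And>h. h \<in> H1 E w m \<beta> \<Longrightarrow> H1_norm E w m \<beta> h < \<delta> \<Longrightarrow> cmod (L h) < 1"
    unfolding L0 by auto
  show thesis
  proof (rule that)
    show "2 / \<delta> \<ge> 0" using \<delta>(1) by simp
    fix g assume g: "g \<in> H1 E w m \<beta>"
    show "cmod (L g) \<le> 2 / \<delta> * H1_norm E w m \<beta> g"
    proof (rule field_le_epsilon)
      fix e :: real assume "e > 0"
      \<comment> \<open>The excess over the norm makes \<open>s\<close> positive even if the norm is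
        0, and is chosen so that \<open>1 / k = 2 * s / \<delta>\<close> exceeds the claimed bound
        by exactly \<open>e\<close>.\<close>
      define s where "s = H1_norm E w m \<beta> g + e * \<delta> / 2"
      have s: "s > 0" "H1_norm E w m \<beta> g \<le> s"
        using H1_norm_nonneg[OF g] \<open>e > 0\<close> \<delta>(1) unfolding s_def by (simp_all add: add_nonneg_pos)
      define k where "k = \<delta> / (2 * s)"
      have k: "k > 0" using s \<delta>(1) unfolding k_def by simp
      have "H1_norm E w m \<beta> (\<lambda>x. of_real k * g x) \<le> k * H1_norm E w m \<beta> g"
        using H1_norm_scale[OF g, of "of_real k"] k by simp
      also have "\<dots> \<le> k * s"
        using s k by (intro mult_left_mono) auto
      also have "\<dots> < \<delta>"
        using s \<delta>(1) unfolding k_def by simp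
      finally have "cmod (L (\<lambda>x. of_real k * g x)) < 1"
        by (rule \<delta>(2)[OF H1_scale[OF g]])
      then have "k * cmod (L g) < 1"
        using k by (simp add: scale[OF g] norm_mult)
      then have "cmod (L g) < 1 / k"
        using k by (simp add: field_simps)
      also have "1 / k = 2 / \<delta> * H1_norm E w m \<beta> g + e"
        using \<delta>(1) unfolding k_def s_def by (simp add: field_simps)
      finally show "cmod (L g) \<le> 2 / \<delta> * H1_norm E w m \<beta> g + e" by simp
    qed
  qed
qed

text \<open>Membership and the formula are proved together, because additivity of \<open>L\<close>
  may be applied only once the partial sum is known to lie in \<open>H1\<close>.\<close>

lemma H1_linear_sum:
  assumes lin: "H1_linear E w m \<beta> L"
    and "finite S" "\<And>i. i \<in> S \<Longrightarrow> h i \<in> H1_fin E w m \<beta>"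
  shows "(\<lambda>x. \<Sum>i\<in>S. k i * h i x) \<in> H1_fin E w m \<beta> \<and>
    L (\<lambda>x. \<Sum>i\<in>S. k i * h i x) = (\<Sum>i\<in>S. k i * L (h i))"
  using assms(2,3)
proof (induction S rule: finite_induct)
  case empty
  have "(\<lambda>_. 0) \<in> H1 E w m \<beta>"
    using zero_in_H1_fin H1_fin_subset by blast
  from H1_linear_scale[OF lin this, of 0] show ?case
    using zero_in_H1_fin by simp
next
  case (insert i S)
  let ?T = "\<lambda>x. \<Sum>i\<in>S. k i * h i x"
  have T: "?T \<in> H1_fin E w m \<beta>" "L ?T = (\<Sum>i\<in>S. k i * L (h i))"
    using insert by auto
  have i: "h i \<in> H1_fin E w m \<beta>" "(\<lambda>x. k i * h i x) \<in> H1_fin E w m \<beta>"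
    using insert.prems H1_fin_scale by auto
  have "L (\<lambda>x. k i * h i x + ?T x) = k i * L (h i) + L ?T"
  proof -
    have H1: "?T \<in> H1 E w m \<beta>" "h i \<in> H1 E w m \<beta>" "(\<lambda>x. k i * h i x) \<in> H1 E w m \<beta>"
      using T(1) i H1_fin_subset by blast+
    have "L (\<lambda>x. k i * h i x + ?T x) = L (\<lambda>x. k i * h i x) + L ?T"
      by (rule H1_linear_add[OF lin H1(3,1)])
    moreover have "L (\<lambda>x. k i * h i x) = k i * L (h i)"
      by (rule H1_linear_scale[OF lin H1(2)])
    ultimately show ?thesis by simp
  qed
  then show ?case
    using insert.hyps T(2) H1_fin_add[OF i(2) T(1)] by simp
qed

text \<open>Up to a scalar such a function is an atom: \<open>s\<close>, the sum of the moduli,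
  dominates \<open>h\<close> everywhere, and dividing by \<open>s * mass R\<close> gives the
  required size.\<close>

lemma mean_zero_in_H1_fin:
  assumes R: "R \<in> admissible E w \<beta>"
    and h: "\<And>x. x \<notin> R \<Longrightarrow> h x = 0" "(\<Sum>x\<in>R. m x *\<^sub>R h x) = 0"
  shows "h \<in> H1_fin E w m \<beta>"
proof (cases "\<forall>x. h x = 0")
  case True
  then have "h = (\<lambda>_. 0)" by auto
  then show ?thesis using zero_in_H1_fin by simp
next
  case False
  have fin: "finite R" by (rule finite_adm[OF R])
  define s where "s = (\<Sum>x\<in>R. cmod (h x))"
  obtain y where y: "h y \<noteq> 0" using False by blast
  then have yR: "y \<in> R" using h(1) by blast
  have le: "cmod (h x) \<le> s" for x
  proof (cases "x \<in> R")
    case True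
    then show ?thesis
      unfolding s_def using fin by (intro member_le_sum) auto
  next
    case False
    then show ?thesis
      using h(1) unfolding s_def by (simp add: sum_nonneg)
  qed
  have s: "s > 0"
    using le[of y] y by (smt (verit) zero_less_norm_iff)
  have M: "mass R > 0"
    using mass_pos[OF fin] yR by blast
  define k where "k = s * mass R"
  have k: "k > 0" unfolding k_def using s M by simp
  have "atom E w m \<beta> (\<lambda>x. of_real (1 / k) * h x)"
    unfolding atom_iff
  proof (intro bexI[OF _ R] conjI allI impI)
    fix x
    show "x \<notin> R \<Longrightarrow> of_real (1 / k) * h x = 0" using h(1) by simp
    have "cmod (of_real (1 / k) * h x) = cmod (h x) / k"
      using k by (simp add: norm_mult norm_divide)
    also have "\<dots> \<le> s / k"
      using le k by (intro divide_right_mono) auto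
    also have "\<dots> = inverse (mass R)"
      using s unfolding k_def by (simp add: field_simps)
    finally show "cmod (of_real (1 / k) * h x) \<le> inverse (mass R)" .
  next
    have "(\<Sum>x\<in>R. m x *\<^sub>R (of_real (1 / k) * h x)) = of_real (1 / k) * (\<Sum>x\<in>R. m x *\<^sub>R h x)"
      by (simp add: sum_distrib_left)
    then show "(\<Sum>x\<in>R. m x *\<^sub>R (of_real (1 / k) * h x)) = 0" using h(2) by simp
  qed
  then have "(\<lambda>x. of_real k * (of_real (1 / k) * h x)) \<in> H1_fin E w m \<beta>"
    by (intro H1_fin_scale atom_in_H1_fin)
  moreover have "(\<lambda>x. of_real k * (of_real (1 / k) * h x)) = h"
    using k by (simp add: fun_eq_iff)
  ultimately show ?thesis by simp
qed

section \<open>The function that represents a functional\<close>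

definition bump :: "'v \<Rightarrow> 'v \<Rightarrow> complex" where
  "bump x y = (if y = x then of_real (1 / m x) else 0)"

definition bump_diff :: "'v \<Rightarrow> 'v \<Rightarrow> complex" where
  "bump_diff x y = bump x y - bump (w 0) y"

lemma sum_bump:
  assumes "finite R" "x \<in> R"
  shows "(\<Sum>y\<in>R. m y *\<^sub>R bump x y) = 1"
proof -
  have "(\<Sum>y\<in>R. m y *\<^sub>R bump x y) = (\<Sum>y\<in>R. if y = x then 1 else 0)"
    using m_pos by (intro sum.cong) (auto simp: bump_def scaleR_conv_of_real less_imp_neq[symmetric])
  then show ?thesis using assms by simp
qed

lemma bump_diff_in_H1_fin: "bump_diff x \<in> H1_fin E w m \<beta>"
proof -
  obtain R where R: "R \<in> admissible E w \<beta>" "x \<in> R" "w 0 \<in> R"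
    using common_adm by blast
  have "(\<Sum>y\<in>R. m y *\<^sub>R bump_diff x y) = 0"
    using sum_bump[OF finite_adm[OF R(1)]] R(2,3)
    by (simp add: bump_diff_def scaleR_diff_right sum_subtractf)
  moreover have "bump_diff x y = 0" if "y \<notin> R" for y
    using R that by (auto simp: bump_diff_def bump_def)
  ultimately show ?thesis
    using mean_zero_in_H1_fin[OF R(1)] by blast
qed

text \<open>If \<open>L\<close> is integration against \<open>f\<close>, this is
  \<open>f x - f (w 0)\<close>: among the representatives modulo constants, the one vanishing at the
  origin.\<close>

definition density_of :: "(('v \<Rightarrow> complex) \<Rightarrow> complex) \<Rightarrow> 'v \<Rightarrow> complex" where
  "density_of L x = L (bump_diff x)"

text \<open>Expand \<open>h\<close> in the normalised point masses with coefficients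
  \<open>m x *\<^sub>R h x\<close>. These coefficients sum to 0, so each mass may be replaced by its
  difference with the one at the origin, whether or not the origin lies in \<open>R\<close>.\<close>

lemma functional_on_mean_zero:
  assumes lin: "H1_linear E w m \<beta> L" and fin: "finite R"
    and h: "\<And>x. x \<notin> R \<Longrightarrow> h x = 0" "(\<Sum>x\<in>R. m x *\<^sub>R h x) = 0"
  shows "L h = (\<Sum>x\<in>R. m x *\<^sub>R (density_of L x * h x))"
proof -
  have "h y = (\<Sum>x\<in>R. (m x *\<^sub>R h x) * bump_diff x y)" for y
  proof -
    have "(\<Sum>x\<in>R. (m x *\<^sub>R h x) * bump_diff x y)
        = (\<Sum>x\<in>R. (m x *\<^sub>R h x) * bump x y) - (\<Sum>x\<in>R. m x *\<^sub>R h x) * bump (w 0) y"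
      unfolding bump_diff_def right_diff_distrib sum_subtractf sum_distrib_right ..
    also have "\<dots> = (\<Sum>x\<in>R. (m x *\<^sub>R h x) * bump x y)"
      using h(2) by simp
    also have "\<dots> = (\<Sum>x\<in>R. if y = x then h x else 0)"
      using m_pos by (intro sum.cong)
        (auto simp: bump_def scaleR_conv_of_real less_imp_neq[symmetric])
    also have "\<dots> = h y"
      using fin h(1) by auto
    finally show ?thesis by simp
  qed
  then have "h = (\<lambda>y. \<Sum>x\<in>R. (m x *\<^sub>R h x) * bump_diff x y)" by blast
  then have "L h = L (\<lambda>y. \<Sum>x\<in>R. (m x *\<^sub>R h x) * bump_diff x y)" by (rule arg_cong)
  also have "\<dots> = (\<Sum>x\<in>R. (m x *\<^sub>R h x) * L (bump_diff x))"
    by (rule H1_linear_sum[OF lin fin bump_diff_in_H1_fin, THEN conjunct2])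
  finally show ?thesis
    by (simp add: density_of_def mult.commute)
qed

lemma functional_on_atom:
  assumes lin: "H1_linear E w m \<beta> L" and a: "atom E w m \<beta> a"
  shows "L a = (LINT x|vmeasure m. density_of L x * a x)"
proof -
  obtain R where R: "R \<in> admissible E w \<beta>" "\<And>x. x \<notin> R \<Longrightarrow> a x = 0" "(\<Sum>x\<in>R. m x *\<^sub>R a x) = 0"
    using a unfolding atom_iff by blast
  have fin: "finite R" by (rule finite_adm[OF R(1)])
  show ?thesis
    using functional_on_mean_zero[OF lin fin, of a] R(2,3)
      integral_mult_support[OF fin, of a "density_of L"] by simp
qed

lemma functional_on_H1_fin:
  assumes lin: "H1_linear E w m \<beta> L" and g: "g \<in> H1_fin E w m \<beta>"
  shows "L g = (LINT x|vmeasure m. density_of L x * g x)"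
proof -
  obtain n :: nat and c a where a: "\<And>j. j < n \<Longrightarrow> atom E w m \<beta> (a j)"
    and g: "g = (\<lambda>x. \<Sum>j<n. c j * a j x)"
    using g unfolding H1_fin_def by blast
  have "L g = (\<Sum>j<n. c j * L (a j))"
    unfolding g using H1_linear_sum[OF lin, of "{..<n}" a c] atom_in_H1_fin(1)[OF a] by simp
  also have "\<dots> = (\<Sum>j<n. c j * (LINT x|vmeasure m. density_of L x * a j x))"
    using functional_on_atom[OF lin a] by simp
  also have "\<dots> = (LINT x|vmeasure m. density_of L x * g x)"
    unfolding g by (rule integral_mult_atomic_sum[OF a, symmetric])
  finally show ?thesis .
qed

section \<open>Recovering mean oscillations from integrals against atoms\<close>

lemma mean_deviation_sum:
  assumes "finite R" "R \<noteq> {}"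
  shows "(\<Sum>x\<in>R. m x *\<^sub>R (f x - mean_on m f R)) = 0"
proof -
  have "(\<Sum>x\<in>R. m x *\<^sub>R (f x - mean_on m f R))
      = (\<Sum>x\<in>R. m x *\<^sub>R f x) - mass R *\<^sub>R mean_on m f R"
    by (simp add: scaleR_diff_right sum_subtractf mass_def scaleR_sum_left)
  then show ?thesis
    using mass_pos[OF assms] by (simp add: mean_on_finite[OF assms(1)] scaleR_conv_of_real)
qed

lemma cmod_mean_on_le:
  assumes "finite R" "R \<noteq> {}" "\<And>x. x \<in> R \<Longrightarrow> cmod (f x) \<le> b"
  shows "cmod (mean_on m f R) \<le> b"
proof -
  have "cmod (\<Sum>x\<in>R. m x *\<^sub>R f x) \<le> (\<Sum>x\<in>R. m x * b)"
    using assms(3) m_nonneg by (intro sum_norm_le) (simp add: mult_left_mono)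
  also have "\<dots> = b * mass R"
    by (simp add: mass_def sum_distrib_left mult.commute)
  finally show ?thesis
    using mass_pos[OF assms(1,2)] by (simp add: mean_on_finite[OF assms(1)] norm_divide divide_le_eq)
qed

text \<open>The mean oscillation of \<open>f\<close> is attained, up to the factor 2, on the atom obtained by
  centring the conjugate phase of \<open>f - f\<^sub>R\<close>.\<close>

lemma mean_osc_eq_atom:
  assumes R: "R \<in> admissible E w \<beta>"
  obtains a where "atom E w m \<beta> a" "of_real (mean_osc m f R) = 2 * (LINT x|vmeasure m. f x * a x)"
proof (cases "R = {}")
  case True
  \<comment> \<open>The locale does not exclude an empty \<open>R\<close>; its oscillation is 0
    because division by 0 gives 0, and the zero atom realises it.\<close>
  show thesis
    by (rule that[OF atom_zero]) (simp add: mean_osc_finite True)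
next
  case False
  have fin: "finite R" by (rule finite_adm[OF R])
  have M: "mass R > 0" by (rule mass_pos[OF fin False])
  define z where "z = mean_on m f R"
  \<comment> \<open>The conjugate phase turns \<open>f - z\<close> into its modulus; where
    \<open>f x = z\<close> the convention \<open>sgn 0 = 0\<close> fits.\<close>
  define u where "u x = cnj (sgn (f x - z))" for x
  define v where "v = mean_on m u R"
  \<comment> \<open>Both \<open>u\<close> and its mean \<open>v\<close> have modulus at most 1, so
    \<open>u - v\<close> has modulus at most 2; the factor 2 in the denominator compensates.\<close>
  define a where "a x = (if x \<in> R then (u x - v) / of_real (2 * mass R) else 0)" for x
  have u: "cmod (u x) \<le> 1" for x
    unfolding u_def by (simp add: norm_sgn)
  then have v: "cmod v \<le> 1"
    unfolding v_def by (rule cmod_mean_on_le[OF fin False])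
  have a_sum: "(\<Sum>x\<in>R. m x *\<^sub>R a x) = 0"
  proof -
    have "(\<Sum>x\<in>R. m x *\<^sub>R a x) = (\<Sum>x\<in>R. m x *\<^sub>R (u x - v)) / of_real (2 * mass R)"
      unfolding sum_divide_distrib by (intro sum.cong) (simp_all add: a_def scaleR_conv_of_real)
    then show ?thesis
      unfolding v_def mean_deviation_sum[OF fin False] by simp
  qed
  have a_bound: "cmod (a x) \<le> inverse (mass R)" for x
  proof (cases "x \<in> R")
    case True
    have "cmod (u x - v) \<le> 2"
      using norm_triangle_ineq4[of "u x" v] u[of x] v by simp
    then have "cmod (u x - v) / (2 * mass R) \<le> 2 / (2 * mass R)"
      using M by (intro divide_right_mono) auto
    also have "\<dots> = inverse (mass R)"
      by (simp add: field_simps)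
    finally show ?thesis
      using True M by (simp add: a_def norm_divide norm_mult)
  qed (use M in \<open>simp add: a_def\<close>)
  have "atom E w m \<beta> a"
    unfolding atom_iff using R a_sum a_bound by (intro bexI[OF _ R]) (simp add: a_def)
  moreover have "of_real (mean_osc m f R) = 2 * (LINT x|vmeasure m. f x * a x)"
  proof -
    have phase: "(f x - z) * u x = of_real (cmod (f x - z))" for x
    proof -
      have "(f x - z) * cnj (f x - z) / of_real (cmod (f x - z)) = of_real (cmod (f x - z))"
        by (simp add: complex_norm_square[symmetric] power2_eq_square del: complex_cnj_diff)
      then show ?thesis
        unfolding u_def by (simp add: sgn_eq del: complex_cnj_diff)
    qed
    have "(LINT x|vmeasure m. f x * a x) = (\<Sum>x\<in>R. m x *\<^sub>R (f x * a x)) - z * (\<Sum>x\<in>R. m x *\<^sub>R a x)"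
      unfolding a_sum using integral_mult_support[OF fin, of a f] by (simp add: a_def)
    also have "\<dots> = (\<Sum>x\<in>R. m x *\<^sub>R ((f x - z) * a x))"
      by (simp add: sum_distrib_left sum_subtractf[symmetric] algebra_simps)
    \<comment> \<open>The term with \<open>v\<close> is separated because the deviation
      \<open>f - z\<close> has weighted sum 0, so centring \<open>u\<close> does not change the
      integral.\<close>
    also have "\<dots> = (\<Sum>x\<in>R. (m x *\<^sub>R ((f x - z) * u x) - v * (m x *\<^sub>R (f x - z))) / of_real (2 * mass R))"
      by (intro sum.cong refl) (simp add: a_def algebra_simps diff_divide_distrib add_divide_distrib scaleR_conv_of_real)
    also have "\<dots> = ((\<Sum>x\<in>R. m x *\<^sub>R ((f x - z) * u x)) - v * (\<Sum>x\<in>R. m x *\<^sub>R (f x - z)))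
        / of_real (2 * mass R)"
      by (simp add: sum_divide_distrib[symmetric] sum_subtractf sum_distrib_left)
    also have "\<dots> = (\<Sum>x\<in>R. m x *\<^sub>R of_real (cmod (f x - z))) / of_real (2 * mass R)"
      unfolding phase using mean_deviation_sum[OF fin False, of f] by (simp add: z_def)
    finally show ?thesis
      by (simp add: mean_osc_finite[OF fin] z_def scaleR_conv_of_real)
  qed
  ultimately show thesis by (rule that)
qed

text \<open>The dual norm is a supremum of reals, so boundedness of \<open>L\<close> is established
  before values are compared with it. Atoms have norm at most 1, hence \<open>cmod (L a)\<close> is
  at most the dual norm, and the factor 2 is that of \<open>mean_osc_eq_atom\<close>.\<close>

lemma representation:
  assumes lin: "H1_linear E w m \<beta> L" and cont: "H1_continuous E w m \<beta> L"
  shows "density_of L \<in> BMO E w m \<beta>" "bounded_extension E w m \<beta> (density_of L) L"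
    "BMO_norm E w m \<beta> (density_of L) \<le> 2 * H1_dual_norm E w m \<beta> L"
proof -
  obtain B where B: "B \<ge> 0" "\<And>g. g \<in> H1 E w m \<beta> \<Longrightarrow> cmod (L g) \<le> B * H1_norm E w m \<beta> g"
    using H1_continuous_imp_bounded[OF lin cont] by blast
  show "bounded_extension E w m \<beta> (density_of L) L"
    unfolding bounded_extension_def H1_bounded_def
  proof (intro conjI ballI exI)
    fix g assume g: "g \<in> H1_fin E w m \<beta>"
    show "integrable (vmeasure m) (\<lambda>x. density_of L x * g x)"
      by (intro integrable_mult_finite_support H1_fin_finite_support g)
    show "L g = (LINT x|vmeasure m. density_of L x * g x)"
      by (rule functional_on_H1_fin[OF lin g])
  qed (rule lin B(2) | assumption)+
  have dual: "cmod (L g) \<le> H1_dual_norm E w m \<beta> L"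
    if g: "g \<in> H1 E w m \<beta>" "H1_norm E w m \<beta> g \<le> 1" for g
    unfolding H1_dual_norm_def
  proof (rule cSup_upper)
    show "bdd_above {cmod (L g) |g. g \<in> H1 E w m \<beta> \<and> H1_norm E w m \<beta> g \<le> 1}"
    proof (rule bdd_aboveI)
      fix t assume "t \<in> {cmod (L g) |g. g \<in> H1 E w m \<beta> \<and> H1_norm E w m \<beta> g \<le> 1}"
      then obtain h where h: "h \<in> H1 E w m \<beta>" "H1_norm E w m \<beta> h \<le> 1" "t = cmod (L h)"
        by blast
      then show "t \<le> B"
        using B(2)[OF h(1)] mult_left_mono[OF h(2) B(1)] by simp
    qed
  qed (use g in blast)
  have osc: "mean_osc m (density_of L) R \<le> 2 * H1_dual_norm E w m \<beta> L"
    if R: "R \<in> admissible E w \<beta>" for R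
  proof -
    obtain a where a: "atom E w m \<beta> a"
      "of_real (mean_osc m (density_of L) R) = 2 * (LINT x|vmeasure m. density_of L x * a x)"
      using mean_osc_eq_atom[OF R] by blast
    have "mean_osc m (density_of L) R = cmod (of_real (mean_osc m (density_of L) R))"
      using mean_osc_nonneg[OF R] by simp
    also have "\<dots> = 2 * cmod (L a)"
      unfolding a(2) functional_on_atom[OF lin a(1)] by (simp add: norm_mult)
    also have "\<dots> \<le> 2 * H1_dual_norm E w m \<beta> L"
      using dual[of a] atom_in_H1_fin[OF a(1)] H1_fin_subset by auto
    finally show ?thesis .
  qed
  then show "density_of L \<in> BMO E w m \<beta>"
    unfolding BMO_def bdd_above_def by blast
  show "BMO_norm E w m \<beta> (density_of L) \<le> 2 * H1_dual_norm E w m \<beta> L"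
    unfolding BMO_norm_def using osc by (rule cSUP_least[OF admissible_nonempty])
qed

end

section \<open>Duality\<close>

theorem theorem4p10:
  fixes E :: "'v \<Rightarrow> 'v \<Rightarrow> bool" and w :: "nat \<Rightarrow> 'v"
    and m :: "'v \<Rightarrow> real" and \<beta> :: real
  assumes tree: "is_tree E"
    and root: "geodesic_ray E w"
    and flow: "flow_measure E w m"
    and doubling: "locally_doubling E m"
    and beta: "\<beta> \<ge> 12"
  shows
    "(H1_fin E w m \<beta> \<subseteq> H1 E w m \<beta> \<and>
      (\<forall>g\<in>H1 E w m \<beta>. \<forall>\<epsilon>>0. \<exists>h\<in>H1_fin E w m \<beta>. H1_norm E w m \<beta> (\<lambda>x. g x - h x) < \<epsilon>) \<and>
      (\<exists>C>0. \<forall>f\<in>BMO E w m \<beta>. \<exists>L.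
         bounded_extension E w m \<beta> f L \<and>
         (\<forall>L'. bounded_extension E w m \<beta> f L' \<longrightarrow> (\<forall>g\<in>H1 E w m \<beta>. L' g = L g)) \<and>
         H1_dual_norm E w m \<beta> L \<le> C * BMO_norm E w m \<beta> f))
     \<and>
     (\<exists>C>0. \<forall>L. H1_linear E w m \<beta> L \<and> H1_continuous E w m \<beta> L \<longrightarrow>
         (\<exists>f\<in>BMO E w m \<beta>.
            bounded_extension E w m \<beta> f L \<and>
            BMO_norm E w m \<beta> f \<le> C * H1_dual_norm E w m \<beta> L))"
proof -
  have pos: "\<And>x. m x > 0"
    using flow unfolding flow_measure_def by blast
  interpret hardy E w m \<beta>
  proof
    show "m x > 0" for x by (rule pos)
    show "finite R" if "R \<in> admissible E w \<beta>" for R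
      by (rule finite_admissible[OF tree pos doubling that])
    show "\<exists>R\<in>admissible E w \<beta>. x \<in> R \<and> y \<in> R" for x y
      by (rule common_admissible_set[OF tree root]) (use beta in simp)
  qed
  have dense: "\<forall>g\<in>H1 E w m \<beta>. \<forall>\<epsilon>>0. \<exists>h\<in>H1_fin E w m \<beta>. H1_norm E w m \<beta> (\<lambda>x. g x - h x) < \<epsilon>"
  proof (intro ballI allI impI)
    fix g and \<epsilon> :: real assume "g \<in> H1 E w m \<beta>" "\<epsilon> > 0"
    then obtain h where "h \<in> H1_fin E w m \<beta>" "H1_norm E w m \<beta> (\<lambda>x. g x - h x) < \<epsilon>"
      by (rule H1_fin_dense)
    then show "\<exists>h\<in>H1_fin E w m \<beta>. H1_norm E w m \<beta> (\<lambda>x. g x - h x) < \<epsilon>"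
      by (intro bexI[of _ h])
  qed
  have direct: "\<exists>L. bounded_extension E w m \<beta> f L \<and>
      (\<forall>L'. bounded_extension E w m \<beta> f L' \<longrightarrow> (\<forall>g\<in>H1 E w m \<beta>. L' g = L g)) \<and>
      H1_dual_norm E w m \<beta> L \<le> 1 * BMO_norm E w m \<beta> f" if f: "f \<in> BMO E w m \<beta>" for f
  proof (intro exI conjI allI impI ballI)
    show "bounded_extension E w m \<beta> f (pairing f)"
      by (rule bounded_extension_pairing[OF f])
    show "L' g = pairing f g" if "bounded_extension E w m \<beta> f L'" "g \<in> H1 E w m \<beta>" for L' g
      by (rule bounded_extension_unique[OF bounded_extension_pairing[OF f] that])
    show "H1_dual_norm E w m \<beta> (pairing f) \<le> 1 * BMO_norm E w m \<beta> f"
      using H1_dual_norm_pairing_le[OF f] by simp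
  qed
  have converse: "\<exists>f\<in>BMO E w m \<beta>. bounded_extension E w m \<beta> f L \<and>
      BMO_norm E w m \<beta> f \<le> 2 * H1_dual_norm E w m \<beta> L"
    if L: "H1_linear E w m \<beta> L \<and> H1_continuous E w m \<beta> L" for L
    using representation[OF conjunct1[OF L] conjunct2[OF L]] by (intro bexI[of _ "density_of L"] conjI)
  show ?thesis
  proof (intro conjI)
    show "H1_fin E w m \<beta> \<subseteq> H1 E w m \<beta>" by (rule H1_fin_subset)
    show "\<forall>g\<in>H1 E w m \<beta>. \<forall>\<epsilon>>0. \<exists>h\<in>H1_fin E w m \<beta>. H1_norm E w m \<beta> (\<lambda>x. g x - h x) < \<epsilon>"
      by (rule dense)
    show "\<exists>C>0. \<forall>f\<in>BMO E w m \<beta>. \<exists>L. bounded_extension E w m \<beta> f L \<and>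
        (\<forall>L'. bounded_extension E w m \<beta> f L' \<longrightarrow> (\<forall>g\<in>H1 E w m \<beta>. L' g = L g)) \<and>
        H1_dual_norm E w m \<beta> L \<le> C * BMO_norm E w m \<beta> f"
      by (rule exI[of _ 1], rule conjI[OF zero_less_one], rule ballI, rule direct)
    show "\<exists>C>0. \<forall>L. H1_linear E w m \<beta> L \<and> H1_continuous E w m \<beta> L \<longrightarrow>
        (\<exists>f\<in>BMO E w m \<beta>. bounded_extension E w m \<beta> f L \<and>
          BMO_norm E w m \<beta> f \<le> C * H1_dual_norm E w m \<beta> L)"
      by (rule exI[of _ 2], rule conjI[OF zero_less_numeral], rule allI, rule impI, rule converse)
  qed
qed

end
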